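(* Let $\psi\colon\mathcal{T}\to\mathcal{T}'$ be an exact equivalence of triangulated categories. Then the Toda brackets for $\mathcal{T}$ and $\mathcal{T}'$ agree: for every sequence of composable maps $A_n\xrightarrow{f_n}A_{n-1}\xrightarrow{f_{n-1}}\cdots\xrightarrow{f_2}A_1\xrightarrow{f_1}A_0$ in $\mathcal{T}$ and every $\theta\in\mathcal{T}(\Sigma^{n-2}A_n,A_0)$, one has $\theta\in\langle f_1,\dots,f_n\rangle_T$ if and only if $\psi(\theta)\in\langle\psi(f_1),\dots,\psi(f_n)\rangle_T$.
   Context: An exact equivalence is an equivalence of categories commuting with shifts up to natural isomorphism and preserving triangles; $\psi(\theta)$ is regarded as a map $\Sigma^{n-2}\psi(A_n)\to\psi(A_0)$ via the isomorphism $\psi\Sigma\cong\Sigma\psi$. **Filtered objects.** An $n$-filtered object $X$ in a triangulated category $\mathcal{T}$ is an object $X$ with maps $*\cong F_0X\xrightarrow{i_0}F_1X\xrightarrow{i_1}\cdots\to F_{n-1}X\xrightarrow{i_{n-1}}F_nX\cong X$. Let $F_{k+1}X/F_kX$ denote the cofiber of $i_k$, so there are triangles $F_kX\xrightarrow{i_k}F_{k+1}X\xrightarrow{\pi_{k+1}}F_{k+1}X/F_kX\xrightarrow{\delta_k}\Sigma F_kX$. Given a composable sequence $A_{n-1}\xrightarrow{f_{n-1}}A_{n-2}\to\cdots\to A_1\xrightarrow{f_1}A_0$, an $n$-filtered object $X$ is an element of $\{f_1,\dots,f_{n-1}\}$ if and only if $\Sigma^kA_k\cong F_{k+1}X/F_kX$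 for all $k$ and via these isomorphisms $\Sigma^kf_k$ is identified with the composite $F_{k+1}X/F_kX\xrightarrow{\delta_k}\Sigma F_kX\xrightarrow{\Sigma\pi_k}\Sigma(F_kX/F_{k-1}X)$. For such $X$, $\sigma_X'$ is the composite $A_0\cong F_1X\to X$ and $\sigma_X$ is the composite $X\cong F_nX\xrightarrow{\pi_n}F_nX/F_{n-1}X\cong\Sigma^{n-1}A_{n-1}$. **Toda brackets.** For $A_n\xrightarrow{f_n}A_{n-1}\to\cdots\xrightarrow{f_2}A_1\xrightarrow{f_1}A_0$, the $n$-fold Toda bracket $\langle f_1,\dots,f_n\rangle_T$ is the set of all $\theta\in\mathcal{T}(\Sigma^{n-2}A_n,A_0)$ such that there are an $(n-1)$-filtered object $X\in\{f_2,\dots,f_{n-1}\}$ and maps $\beta\colon\Sigma^{n-2}A_n\to X$, $\alpha\colon X\to A_0$ with $\Sigma^{n-2}f_n=\sigma_X\beta$, $f_1=\alpha\sigma_X'$ and $\theta=\alpha\beta$ (here $\sigma_X'\colon A_1\to X$ and $\sigma_X\colon X\to\Sigma^{n-2}A_{n-1}$). *)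

theory Defs
  imports "HOL-Algebra.Group"
begin

section \<open>Categories, functors and natural isomorphisms\<close>

record ('o, 'm) cat =
  Obj :: "'o set"
  Arr :: "'m set"
  Dom :: "'m \<Rightarrow> 'o"
  Cod :: "'m \<Rightarrow> 'o"
  Ide :: "'o \<Rightarrow> 'm"
  Comp :: "'m \<Rightarrow> 'm \<Rightarrow> 'm"  (infixr "\<cdot>\<index>" 70)

definition Hom :: "('o, 'm, 'a) cat_scheme \<Rightarrow> 'o \<Rightarrow> 'o \<Rightarrow> 'm set" where
  "Hom C A B = {f \<in> Arr C. Dom C f = A \<and> Cod C f = B}"

locale category =
  fixes C :: "('o, 'm, 'a) cat_scheme" (structure)
  assumes Dom_Obj: "f \<in> Arr C \<Longrightarrow> Dom C f \<in> Obj C"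
    and Cod_Obj: "f \<in> Arr C \<Longrightarrow> Cod C f \<in> Obj C"
    and Ide_Hom: "A \<in> Obj C \<Longrightarrow> Ide C A \<in> Hom C A A"
    and Comp_Hom: "f \<in> Hom C A B \<Longrightarrow> g \<in> Hom C B D \<Longrightarrow> g \<cdot> f \<in> Hom C A D"
    and Comp_Ide: "f \<in> Hom C A B \<Longrightarrow> f \<cdot> Ide C A = f"
    and Ide_Comp: "f \<in> Hom C A B \<Longrightarrow> Ide C B \<cdot> f = f"
    and Comp_assoc: "f \<in> Hom C A B \<Longrightarrow> g \<in> Hom C B D \<Longrightarrow> h \<in> Hom C D E
          \<Longrightarrow> (h \<cdot> g) \<cdot> f = h \<cdot> (g \<cdot> f)"

definition inverse_arrows :: "('o, 'm, 'a) cat_scheme \<Rightarrow> 'm \<Rightarrow> 'm \<Rightarrow> bool" where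
  "inverse_arrows C f g \<longleftrightarrow>
     f \<in> Hom C (Dom C f) (Cod C f) \<and> g \<in> Hom C (Cod C f) (Dom C f) \<and>
     g \<cdot>\<^bsub>C\<^esub> f = Ide C (Dom C f) \<and> f \<cdot>\<^bsub>C\<^esub> g = Ide C (Cod C f)"

definition Iso :: "('o, 'm, 'a) cat_scheme \<Rightarrow> 'o \<Rightarrow> 'o \<Rightarrow> 'm set" where
  "Iso C A B = {f \<in> Hom C A B. \<exists>g. inverse_arrows C f g}"

definition inv_arr :: "('o, 'm, 'a) cat_scheme \<Rightarrow> 'm \<Rightarrow> 'm" where
  "inv_arr C f = (THE g. inverse_arrows C f g)"

definition zero_object :: "('o, 'm, 'a) cat_scheme \<Rightarrow> 'o \<Rightarrow> bool" where
  "zero_object C Z \<longleftrightarrow> Z \<in> Obj C \<and>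
     (\<forall>A\<in>Obj C. (\<exists>!f. f \<in> Hom C Z A) \<and> (\<exists>!f. f \<in> Hom C A Z))"

record ('o, 'm, 'p, 'q) functor_data =
  fobj :: "'o \<Rightarrow> 'p"
  farr :: "'m \<Rightarrow> 'q"

definition id_functor :: "('o, 'm, 'o, 'm) functor_data" where
  "id_functor = \<lparr>fobj = (\<lambda>A. A), farr = (\<lambda>f. f)\<rparr>"

definition comp_functor ::
  "('p, 'q, 'r, 's) functor_data \<Rightarrow> ('o, 'm, 'p, 'q) functor_data \<Rightarrow> ('o, 'm, 'r, 's) functor_data"
  where "comp_functor G F = \<lparr>fobj = (\<lambda>A. fobj G (fobj F A)), farr = (\<lambda>f. farr G (farr F f))\<rparr>"

locale cat_functor = C: category C + D: category D
  for C :: "('o, 'm, 'a) cat_scheme" and D :: "('p, 'q, 'b) cat_scheme" +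
  fixes F :: "('o, 'm, 'p, 'q) functor_data"
  assumes fobj_Obj: "A \<in> Obj C \<Longrightarrow> fobj F A \<in> Obj D"
    and farr_Hom: "f \<in> Hom C A B \<Longrightarrow> farr F f \<in> Hom D (fobj F A) (fobj F B)"
    and farr_Ide: "A \<in> Obj C \<Longrightarrow> farr F (Ide C A) = Ide D (fobj F A)"
    and farr_Comp: "f \<in> Hom C A B \<Longrightarrow> g \<in> Hom C B E
          \<Longrightarrow> farr F (g \<cdot>\<^bsub>C\<^esub> f) = farr F g \<cdot>\<^bsub>D\<^esub> farr F f"

definition natural_iso ::
  "('o, 'm, 'a) cat_scheme \<Rightarrow> ('p, 'q, 'b) cat_scheme \<Rightarrow>
   ('o, 'm, 'p, 'q) functor_data \<Rightarrow> ('o, 'm, 'p, 'q) functor_data \<Rightarrow> ('o \<Rightarrow> 'q) \<Rightarrow> bool" where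
  "natural_iso C D F G t \<longleftrightarrow>
     (\<forall>A\<in>Obj C. t A \<in> Iso D (fobj F A) (fobj G A)) \<and>
     (\<forall>A\<in>Obj C. \<forall>B\<in>Obj C. \<forall>f\<in>Hom C A B. t B \<cdot>\<^bsub>D\<^esub> farr F f = farr G f \<cdot>\<^bsub>D\<^esub> t A)"

locale cat_equivalence = cat_functor C D F
  for C :: "('o, 'm, 'a) cat_scheme" and D :: "('p, 'q, 'b) cat_scheme"
    and F :: "('o, 'm, 'p, 'q) functor_data" +
  assumes quasi_inverse: "\<exists>G \<eta> \<epsilon>. cat_functor D C G \<and>
     natural_iso C C id_functor (comp_functor G F) \<eta> \<and>
     natural_iso D D (comp_functor F G) id_functor \<epsilon>"

section \<open>Triangulated categories\<close>

record ('o, 'm) additive_cat = "('o, 'm) cat" +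
  Add :: "'m \<Rightarrow> 'm \<Rightarrow> 'm"
  Zero :: "'o \<Rightarrow> 'o \<Rightarrow> 'm"

definition hom_group :: "('o, 'm, 'a) additive_cat_scheme \<Rightarrow> 'o \<Rightarrow> 'o \<Rightarrow> 'm monoid" where
  "hom_group C A B = \<lparr>carrier = Hom C A B, monoid.mult = Add C, one = Zero C A B\<rparr>"

definition neg_arr :: "('o, 'm, 'a) additive_cat_scheme \<Rightarrow> 'm \<Rightarrow> 'm" where
  "neg_arr C f = m_inv (hom_group C (Dom C f) (Cod C f)) f"

locale additive_category = category C
  for C :: "('o, 'm, 'a) additive_cat_scheme" (structure) +
  assumes hom_comm_group: "A \<in> Obj C \<Longrightarrow> B \<in> Obj C \<Longrightarrow> comm_group (hom_group C A B)"
    and Comp_Add_right: "f \<in> Hom C A B \<Longrightarrow> f' \<in> Hom C A B \<Longrightarrow> g \<in> Hom C B D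
          \<Longrightarrow> g \<cdot> Add C f f' = Add C (g \<cdot> f) (g \<cdot> f')"
    and Comp_Add_left: "f \<in> Hom C A B \<Longrightarrow> g \<in> Hom C B D \<Longrightarrow> g' \<in> Hom C B D
          \<Longrightarrow> Add C g g' \<cdot> f = Add C (g \<cdot> f) (g' \<cdot> f)"
    and ex_zero_object: "\<exists>Z. zero_object C Z"
    and ex_biproduct: "A \<in> Obj C \<Longrightarrow> B \<in> Obj C \<Longrightarrow>
          \<exists>P\<in>Obj C. \<exists>i\<in>Hom C A P. \<exists>j\<in>Hom C B P. \<exists>p\<in>Hom C P A. \<exists>q\<in>Hom C P B.
            p \<cdot> i = Ide C A \<and> q \<cdot> j = Ide C B \<and> q \<cdot> i = Zero C A B \<and> p \<cdot> j = Zero C B A \<and>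
            Add C (i \<cdot> p) (j \<cdot> q) = Ide C P"

record ('o, 'm) triang_cat = "('o, 'm) additive_cat" +
  Shift :: "('o, 'm, 'o, 'm) functor_data"
  Tri :: "('m \<times> 'm \<times> 'm) set"

abbreviation shO :: "('o, 'm, 'a) triang_cat_scheme \<Rightarrow> 'o \<Rightarrow> 'o" where
  "shO T \<equiv> fobj (Shift T)"

abbreviation shA :: "('o, 'm, 'a) triang_cat_scheme \<Rightarrow> 'm \<Rightarrow> 'm" where
  "shA T \<equiv> farr (Shift T)"

definition candidate_triangle ::
  "('o, 'm, 'a) triang_cat_scheme \<Rightarrow> 'm \<Rightarrow> 'm \<Rightarrow> 'm \<Rightarrow> bool" where
  "candidate_triangle T f g h \<longleftrightarrow>
     (\<exists>A B C. f \<in> Hom T A B \<and> g \<in> Hom T B C \<and> h \<in> Hom T C (shO T A))"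

text \<open>The shift is only required to be an additive self-equivalence, which includes the
  convention that it is an automorphism. The last axiom is the octahedral axiom.\<close>

locale triangulated_category = additive_category T + shift: cat_equivalence T T "Shift T"
  for T :: "('o, 'm, 'a) triang_cat_scheme" (structure) +
  assumes shift_Add: "f \<in> Hom T A B \<Longrightarrow> g \<in> Hom T A B
          \<Longrightarrow> shA T (Add T f g) = Add T (shA T f) (shA T g)"
    and Tri_candidate: "(f, g, h) \<in> Tri T \<Longrightarrow> candidate_triangle T f g h"
    and Tri_iso: "(f, g, h) \<in> Tri T \<Longrightarrow> candidate_triangle T f' g' h'
          \<Longrightarrow> u \<in> Iso T (Dom T f) (Dom T f') \<Longrightarrow> v \<in> Iso T (Dom T g) (Dom T g')
          \<Longrightarrow> w \<in> Iso T (Dom T h) (Dom T h')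
          \<Longrightarrow> v \<cdot> f = f' \<cdot> u \<Longrightarrow> w \<cdot> g = g' \<cdot> v \<Longrightarrow> shA T u \<cdot> h = h' \<cdot> w
          \<Longrightarrow> (f', g', h') \<in> Tri T"
    and Tri_Ide: "A \<in> Obj T \<Longrightarrow> zero_object T Z
          \<Longrightarrow> (Ide T A, Zero T A Z, Zero T Z (shO T A)) \<in> Tri T"
    and Tri_ex: "f \<in> Arr T \<Longrightarrow> \<exists>g h. (f, g, h) \<in> Tri T"
    and Tri_rotate: "candidate_triangle T f g h
          \<Longrightarrow> (f, g, h) \<in> Tri T \<longleftrightarrow> (g, h, neg_arr T (shA T f)) \<in> Tri T"
    and Tri_fill: "(f, g, h) \<in> Tri T \<Longrightarrow> (f', g', h') \<in> Tri T
          \<Longrightarrow> u \<in> Hom T (Dom T f) (Dom T f') \<Longrightarrow> v \<in> Hom T (Dom T g) (Dom T g')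
          \<Longrightarrow> v \<cdot> f = f' \<cdot> u
          \<Longrightarrow> \<exists>w\<in>Hom T (Dom T h) (Dom T h'). w \<cdot> g = g' \<cdot> v \<and> shA T u \<cdot> h = h' \<cdot> w"
    and Tri_octahedral: "f \<in> Hom T A B \<Longrightarrow> g \<in> Hom T B C
          \<Longrightarrow> (f, p\<^sub>1, d\<^sub>1) \<in> Tri T \<Longrightarrow> (g \<cdot> f, p\<^sub>2, d\<^sub>2) \<in> Tri T \<Longrightarrow> (g, p\<^sub>3, d\<^sub>3) \<in> Tri T
          \<Longrightarrow> \<exists>a b. (a, b, shA T p\<^sub>1 \<cdot> d\<^sub>3) \<in> Tri T \<and>
                a \<cdot> p\<^sub>1 = p\<^sub>2 \<cdot> g \<and> d\<^sub>2 \<cdot> a = d\<^sub>1 \<and> b \<cdot> p\<^sub>2 = p\<^sub>3 \<and> d\<^sub>3 \<cdot> b = shA T f \<cdot> d\<^sub>2"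

text \<open>The natural isomorphism \<open>\<tau> : \<psi>\<Sigma> \<cong> \<Sigma>\<psi>\<close> is part of the data of an exact equivalence: it
  enters both the preservation of triangles and the identification of \<open>\<psi>(\<Sigma>\<^sup>k A)\<close> with
  \<open>\<Sigma>\<^sup>k (\<psi> A)\<close>.\<close>

locale exact_equivalence =
  T: triangulated_category T + T': triangulated_category T' + cat_equivalence T T' \<psi>
  for T :: "('o, 'm, 'a) triang_cat_scheme" and T' :: "('p, 'q, 'b) triang_cat_scheme"
    and \<psi> :: "('o, 'm, 'p, 'q) functor_data" +
  fixes \<tau> :: "'o \<Rightarrow> 'q"
  assumes shift_natural_iso:
      "natural_iso T T' (comp_functor \<psi> (Shift T)) (comp_functor (Shift T') \<psi>) \<tau>"
    and preserves_Tri: "(f, g, h) \<in> Tri T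
          \<Longrightarrow> (farr \<psi> f, farr \<psi> g, \<tau> (Dom T f) \<cdot>\<^bsub>T'\<^esub> farr \<psi> h) \<in> Tri T'"

text \<open>The isomorphism \<open>\<psi>(\<Sigma>\<^sup>k A) \<rightarrow> \<Sigma>\<^sup>k (\<psi> A)\<close> obtained by iterating \<open>\<tau>\<close>.\<close>

primrec shift_iso ::
  "('o, 'm, 'a) triang_cat_scheme \<Rightarrow> ('p, 'q, 'b) triang_cat_scheme \<Rightarrow>
   ('o, 'm, 'p, 'q) functor_data \<Rightarrow> ('o \<Rightarrow> 'q) \<Rightarrow> nat \<Rightarrow> 'o \<Rightarrow> 'q" where
  "shift_iso T T' \<psi> \<tau> 0 A = Ide T' (fobj \<psi> A)"
| "shift_iso T T' \<psi> \<tau> (Suc k) A = shA T' (shift_iso T T' \<psi> \<tau> k A) \<cdot>\<^bsub>T'\<^esub> \<tau> ((shO T ^^ k) A)"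

section \<open>Filtered objects and Toda brackets\<close>

definition composable_seq ::
  "('o, 'm, 'a) triang_cat_scheme \<Rightarrow> nat \<Rightarrow> (nat \<Rightarrow> 'o) \<Rightarrow> (nat \<Rightarrow> 'm) \<Rightarrow> bool" where
  "composable_seq T n A f \<longleftrightarrow>
     (\<forall>k\<le>n. A k \<in> Obj T) \<and> (\<forall>k\<in>{1..n}. f k \<in> Hom T (A k) (A (k - 1)))"

text \<open>The choice of the cofibers is recorded with the filtered object: \<open>quo X k\<close> is
  \<open>F\<^sub>k\<^sub>+\<^sub>1X/F\<^sub>kX\<close>, \<open>proj X k\<close> is \<open>\<pi>\<^sub>k\<close> (for \<open>k \<ge> 1\<close>), \<open>conn X k\<close> is \<open>\<delta>\<^sub>k\<close>, and \<open>top_iso X\<close> is the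
  isomorphism \<open>F\<^sub>nX \<cong> X\<close>. Only the values at the indices occurring below matter.\<close>

record ('o, 'm) filtered =
  total :: "'o"
  fil :: "nat \<Rightarrow> 'o"
  inc :: "nat \<Rightarrow> 'm"
  top_iso :: "'m"
  quo :: "nat \<Rightarrow> 'o"
  proj :: "nat \<Rightarrow> 'm"
  conn :: "nat \<Rightarrow> 'm"

definition filtered_object ::
  "('o, 'm, 'a) triang_cat_scheme \<Rightarrow> nat \<Rightarrow> ('o, 'm) filtered \<Rightarrow> bool" where
  "filtered_object T n X \<longleftrightarrow>
     zero_object T (fil X 0) \<and>
     top_iso X \<in> Iso T (fil X n) (total X) \<and>
     (\<forall>k<n. inc X k \<in> Hom T (fil X k) (fil X (k + 1)) \<and>
            proj X (k + 1) \<in> Hom T (fil X (k + 1)) (quo X k) \<and>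
            conn X k \<in> Hom T (quo X k) (shO T (fil X k)) \<and>
            (inc X k, proj X (k + 1), conn X k) \<in> Tri T)"

text \<open>The isomorphisms \<open>\<phi>\<^sub>k : \<Sigma>\<^sup>k A\<^sub>k \<cong> F\<^sub>k\<^sub>+\<^sub>1X/F\<^sub>kX\<close> exhibit the \<open>n\<close>-filtered object \<open>X\<close> as an
  element of \<open>{f\<^sub>1, \<dots>, f\<^sub>n\<^sub>-\<^sub>1}\<close>. The maps \<open>\<sigma>'\<^sub>X\<close> and \<open>\<sigma>\<^sub>X\<close> below depend on \<open>\<phi>\<close>.\<close>

definition exhibits_element ::
  "('o, 'm, 'a) triang_cat_scheme \<Rightarrow> nat \<Rightarrow> (nat \<Rightarrow> 'o) \<Rightarrow> (nat \<Rightarrow> 'm) \<Rightarrow>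
   ('o, 'm) filtered \<Rightarrow> (nat \<Rightarrow> 'm) \<Rightarrow> bool" where
  "exhibits_element T n A f X \<phi> \<longleftrightarrow>
     filtered_object T n X \<and>
     (\<forall>k<n. \<phi> k \<in> Iso T ((shO T ^^ k) (A k)) (quo X k)) \<and>
     (\<forall>k\<in>{1..<n}. (shA T (proj X k) \<cdot>\<^bsub>T\<^esub> conn X k) \<cdot>\<^bsub>T\<^esub> \<phi> k
                    = shA T (\<phi> (k - 1)) \<cdot>\<^bsub>T\<^esub> (shA T ^^ k) (f k))"

primrec inc_comp ::
  "('o, 'm, 'a) triang_cat_scheme \<Rightarrow> ('o, 'm) filtered \<Rightarrow> nat \<Rightarrow> nat \<Rightarrow> 'm" where
  "inc_comp T X a 0 = Ide T (fil X a)"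
| "inc_comp T X a (Suc m) = inc X (a + m) \<cdot>\<^bsub>T\<^esub> inc_comp T X a m"

text \<open>\<open>F\<^sub>0X\<close> being zero, \<open>\<pi>\<^sub>1 : F\<^sub>1X \<rightarrow> F\<^sub>1X/F\<^sub>0X\<close> is an isomorphism, so
  \<open>A\<^sub>0 \<cong> F\<^sub>1X/F\<^sub>0X \<cong> F\<^sub>1X\<close>.\<close>

definition sigma' ::
  "('o, 'm, 'a) triang_cat_scheme \<Rightarrow> nat \<Rightarrow> ('o, 'm) filtered \<Rightarrow> (nat \<Rightarrow> 'm) \<Rightarrow> 'm" where
  "sigma' T n X \<phi> =
     top_iso X \<cdot>\<^bsub>T\<^esub> inc_comp T X 1 (n - 1) \<cdot>\<^bsub>T\<^esub> inv_arr T (proj X 1) \<cdot>\<^bsub>T\<^esub> \<phi> 0"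

definition sigma ::
  "('o, 'm, 'a) triang_cat_scheme \<Rightarrow> nat \<Rightarrow> ('o, 'm) filtered \<Rightarrow> (nat \<Rightarrow> 'm) \<Rightarrow> 'm" where
  "sigma T n X \<phi> = inv_arr T (\<phi> (n - 1)) \<cdot>\<^bsub>T\<^esub> proj X n \<cdot>\<^bsub>T\<^esub> inv_arr T (top_iso X)"

text \<open>\<open>\<langle>f\<^sub>1, \<dots>, f\<^sub>n\<rangle>\<close> for \<open>n \<ge> 2\<close>. The sequence \<open>f\<^sub>2, \<dots>, f\<^sub>n\<^sub>-\<^sub>1\<close> is reindexed to start at
  \<open>A\<^sub>1\<close>.\<close>

definition toda_bracket ::
  "('o, 'm, 'a) triang_cat_scheme \<Rightarrow> nat \<Rightarrow> (nat \<Rightarrow> 'o) \<Rightarrow> (nat \<Rightarrow> 'm) \<Rightarrow> 'm set" where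
  "toda_bracket T n A f =
     {\<theta> \<in> Hom T ((shO T ^^ (n - 2)) (A n)) (A 0).
        \<exists>X \<phi>. exhibits_element T (n - 1) (\<lambda>k. A (k + 1)) (\<lambda>k. f (k + 1)) X \<phi> \<and>
          (\<exists>\<beta> \<in> Hom T ((shO T ^^ (n - 2)) (A n)) (total X). \<exists>\<alpha> \<in> Hom T (total X) (A 0).
             (shA T ^^ (n - 2)) (f n) = sigma T (n - 1) X \<phi> \<cdot>\<^bsub>T\<^esub> \<beta> \<and>
             f 1 = \<alpha> \<cdot>\<^bsub>T\<^esub> sigma' T (n - 1) X \<phi> \<and>
             \<theta> = \<alpha> \<cdot>\<^bsub>T\<^esub> \<beta>)}"

end

(* Exact equivalences reflect triangles because a cone is determined by its map up to isomorphism.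
   Hence a filtered object of T can be transported along psi, and one of T' can be lifted, by lifting
   all its objects and maps one by one. The two filtered objects are related by isomorphisms forming
   commuting squares with psi, the iterates of tau being used on shifts; pasting these squares
   matches sigma, sigma' and the conditions on alpha, beta and theta, and cancelling the
   isomorphisms turns equations in T' into equations in T. *)

theory Submission
  imports Defs
begin

section \<open>Isomorphisms and zero objects\<close>

text \<open>The overview takes uniqueness of cones for granted, but the axioms supply only fill-ins,
  neither unique nor known to be invertible. The five lemma is replaced by a computation: if an
  endomorphism of a cone is compatible with both structure maps, its difference from the identity
  factors through the connecting map and has square zero. Fill-ins act on the third object of a
  triangle, so a map whose cone vanishes is first rotated there; this inverts its shift, and the
  shift, a self-equivalence, reflects invertibility.

  \<psi> reaches objects only up to isomorphism, and \<psi>\<Sigma> agrees with \<Sigma>\<psi> only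
  up to \<tau>. The two directions therefore share one relation, \<open>filtered_comparison\<close>,
  between typed data in the two categories, set up before either side is known to satisfy the
  triangle or attaching conditions. Each condition is shown equivalent across the relation; a
  direction of the theorem then only needs a partner for the given data.\<close>

context category
begin

lemma Hom_iff: "f \<in> Hom C A B \<longleftrightarrow> f \<in> Arr C \<and> Dom C f = A \<and> Cod C f = B"
  by (simp add: Hom_def)

lemma Hom_Obj:
  assumes "f \<in> Hom C A B"
  shows "A \<in> Obj C" "B \<in> Obj C"
  using assms Dom_Obj Cod_Obj by (auto simp: Hom_iff)

lemma Ide_simps [simp]:
  assumes "A \<in> Obj C"
  shows "Ide C A \<in> Arr C" "Dom C (Ide C A) = A" "Cod C (Ide C A) = A"
  using Ide_Hom[OF assms] by (auto simp: Hom_iff)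

lemma Comp_simps [simp]:
  assumes "f \<in> Arr C" "g \<in> Arr C" "Dom C g = Cod C f"
  shows "g \<cdot> f \<in> Arr C" "Dom C (g \<cdot> f) = Dom C f" "Cod C (g \<cdot> f) = Cod C g"
  using Comp_Hom[of f "Dom C f" "Cod C f" g "Cod C g"] assms by (auto simp: Hom_iff)

lemma Comp_Ide_eq [simp]: "f \<in> Arr C \<Longrightarrow> A = Dom C f \<Longrightarrow> f \<cdot> Ide C A = f"
  using Comp_Ide[of f "Dom C f" "Cod C f"] by (auto simp: Hom_iff)

lemma Ide_Comp_eq [simp]: "f \<in> Arr C \<Longrightarrow> B = Cod C f \<Longrightarrow> Ide C B \<cdot> f = f"
  using Ide_Comp[of f "Dom C f" "Cod C f"] by (auto simp: Hom_iff)

lemma Comp_assoc_eq [simp]: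
  assumes "f \<in> Arr C" "g \<in> Arr C" "h \<in> Arr C" "Dom C g = Cod C f" "Dom C h = Cod C g"
  shows "(h \<cdot> g) \<cdot> f = h \<cdot> (g \<cdot> f)"
  using Comp_assoc[of f "Dom C f" "Cod C f" g "Cod C g" h "Cod C h"] assms
  by (auto simp: Hom_iff)

text \<open>Simplification normalises composites to the right, so an equation
  \<open>g \<cdot> f = g' \<cdot> f'\<close> no longer matches inside a longer composite. This is
  its form with a tail \<open>x\<close>; equality of the two sources is read off from the
  equation.\<close>

lemma Comp_extend:
  assumes "g \<cdot> f = g' \<cdot> f'" "x \<in> Arr C" "f \<in> Arr C" "g \<in> Arr C" "f' \<in> Arr C" "g' \<in> Arr C"
    and "Dom C g = Cod C f" "Dom C g' = Cod C f'" "Cod C x = Dom C f"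
  shows "g \<cdot> (f \<cdot> x) = g' \<cdot> (f' \<cdot> x)"
proof -
  have "Dom C f' = Dom C f"
    using assms Comp_simps(2) by metis
  then show ?thesis
    using assms Comp_assoc_eq[of x f g] Comp_assoc_eq[of x f' g'] by (simp del: Comp_assoc_eq)
qed

lemma inverse_arrows_unique:
  assumes "inverse_arrows C f g" "inverse_arrows C f h"
  shows "g = h"
proof -
  have "g = (h \<cdot> f) \<cdot> g"
    using assms by (simp add: inverse_arrows_def Hom_iff)
  also have "\<dots> = h \<cdot> (f \<cdot> g)"
    using assms by (intro Comp_assoc_eq) (auto simp: inverse_arrows_def Hom_iff)
  also have "\<dots> = h"
    using assms by (simp add: inverse_arrows_def Hom_iff)
  finally show ?thesis .
qed

lemma inv_arr_eqI: "inverse_arrows C f g \<Longrightarrow> inv_arr C f = g"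
  unfolding inv_arr_def by (rule the_equality) (auto intro: inverse_arrows_unique)

lemma inverse_inv_arr: "f \<in> Iso C A B \<Longrightarrow> inverse_arrows C f (inv_arr C f)"
  using inv_arr_eqI by (auto simp: Iso_def)

lemma IsoI:
  assumes "f \<in> Hom C A B" "g \<in> Hom C B A" "g \<cdot> f = Ide C A" "f \<cdot> g = Ide C B"
  shows "f \<in> Iso C A B" "inv_arr C f = g"
proof -
  have "inverse_arrows C f g"
    using assms by (simp add: inverse_arrows_def Hom_iff)
  then show "f \<in> Iso C A B" "inv_arr C f = g"
    using assms(1) inv_arr_eqI by (auto simp: Iso_def)
qed

lemma Iso_simps:
  assumes "f \<in> Iso C A B"
  shows "f \<in> Arr C" "Dom C f = A" "Cod C f = B" "A \<in> Obj C" "B \<in> Obj C"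
    "inv_arr C f \<in> Arr C" "Dom C (inv_arr C f) = B" "Cod C (inv_arr C f) = A"
    "inv_arr C f \<cdot> f = Ide C A" "f \<cdot> inv_arr C f = Ide C B"
  using inverse_inv_arr[OF assms] assms Dom_Obj Cod_Obj
  by (auto simp: Iso_def inverse_arrows_def Hom_iff)

lemma Iso_Hom: "f \<in> Iso C A B \<Longrightarrow> f \<in> Hom C A B"
  by (simp add: Iso_def)

lemma Iso_inv_Comp [simp]:
  assumes "f \<in> Iso C A B" "x \<in> Arr C"
  shows "Cod C x = A \<Longrightarrow> inv_arr C f \<cdot> (f \<cdot> x) = x"
    and "Cod C x = B \<Longrightarrow> f \<cdot> (inv_arr C f \<cdot> x) = x"
  using assms(2) Iso_simps[OF assms(1)]
    Comp_assoc_eq[of x f "inv_arr C f"] Comp_assoc_eq[of x "inv_arr C f" f]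
  by (simp_all del: Comp_assoc_eq)

lemma inv_arr_Iso: "f \<in> Iso C A B \<Longrightarrow> inv_arr C f \<in> Iso C B A"
  by (rule IsoI(1)[of _ _ _ f]) (simp_all add: Iso_simps Hom_iff)

lemma Ide_Iso: "A \<in> Obj C \<Longrightarrow> Ide C A \<in> Iso C A A"
  by (rule IsoI(1)[of _ _ _ "Ide C A"]) (simp_all add: Hom_iff)

lemma Comp_Iso:
  assumes "f \<in> Iso C A B" "g \<in> Iso C B D"
  shows "g \<cdot> f \<in> Iso C A D"
  using Iso_simps[OF assms(1)] Iso_simps[OF assms(2)] assms
  by (intro IsoI(1)[of _ _ _ "inv_arr C f \<cdot> inv_arr C g"]) (simp_all add: Hom_iff)

lemma Iso_cancel_left:
  assumes "f \<in> Iso C A B" "x \<in> Hom C D A" "y \<in> Hom C D A"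
  shows "f \<cdot> x = f \<cdot> y \<longleftrightarrow> x = y"
  using assms Iso_inv_Comp(1) by (metis Hom_iff)

lemma Iso_cancel_right:
  assumes "f \<in> Iso C A B" "x \<in> Hom C B D" "y \<in> Hom C B D"
  shows "x \<cdot> f = y \<cdot> f \<longleftrightarrow> x = y"
proof
  assume "x \<cdot> f = y \<cdot> f"
  then have "(x \<cdot> f) \<cdot> inv_arr C f = (y \<cdot> f) \<cdot> inv_arr C f"
    by simp
  then show "x = y"
    using assms Iso_simps[OF assms(1)] by (simp add: Hom_iff)
qed simp

text \<open>The left inverse \<open>g\<close> and the right inverse \<open>h\<close> may come from
  unrelated fill-ins; \<open>g = g \<cdot> (f \<cdot> h) = (g \<cdot> f) \<cdot> h = h\<close>
  identifies them.\<close>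

lemma inverse_halves_Iso:
  assumes "f \<in> Hom C A B" "g \<in> Hom C B A" "h \<in> Hom C B A" "g \<cdot> f = Ide C A" "f \<cdot> h = Ide C B"
  shows "f \<in> Iso C A B"
proof -
  have "g = g \<cdot> (f \<cdot> h)"
    using assms Hom_Obj[OF assms(1)] by (simp add: Hom_iff)
  also have "\<dots> = (g \<cdot> f) \<cdot> h"
    using assms(1-3) by (intro Comp_assoc_eq[symmetric]) (auto simp: Hom_iff)
  also have "\<dots> = h"
    using assms Hom_Obj[OF assms(1)] by (simp add: Hom_iff)
  finally show ?thesis
    using assms IsoI(1) by blast
qed

lemma square_inv:
  assumes "u \<in> Iso C A A'" "v \<in> Iso C B B'" "f \<in> Hom C A B" "f' \<in> Hom C A' B'"
    and "v \<cdot> f = f' \<cdot> u"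
  shows "inv_arr C v \<cdot> f' = f \<cdot> inv_arr C u"
proof -
  note u = Iso_simps[OF assms(1)] and v = Iso_simps[OF assms(2)]
  have f: "f \<in> Arr C" "Dom C f = A" "Cod C f = B" "f' \<in> Arr C" "Dom C f' = A'" "Cod C f' = B'"
    using assms(3,4) by (auto simp: Hom_iff)
  have "v \<cdot> (f \<cdot> inv_arr C u) = f'"
    using Comp_extend[OF assms(5), of "inv_arr C u"] u v f by simp
  then have "inv_arr C v \<cdot> f' = inv_arr C v \<cdot> (v \<cdot> (f \<cdot> inv_arr C u))"
    by simp
  also have "\<dots> = f \<cdot> inv_arr C u"
    using assms(2) u f by simp
  finally show ?thesis .
qed

lemma zero_object_unique:
  assumes "zero_object C Z"
  shows "f \<in> Hom C Z A \<Longrightarrow> g \<in> Hom C Z A \<Longrightarrow> f = g"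
    and "f \<in> Hom C A Z \<Longrightarrow> g \<in> Hom C A Z \<Longrightarrow> f = g"
  using assms Hom_Obj unfolding zero_object_def by metis+

lemma zero_object_Iso:
  assumes "zero_object C Z" "u \<in> Iso C Z W"
  shows "zero_object C W"
proof -
  note u = Iso_simps[OF assms(2)]
  have "\<exists>!f. f \<in> Hom C W A" "\<exists>!f. f \<in> Hom C A W" if A: "A \<in> Obj C" for A
  proof -
    obtain f g where f: "f \<in> Hom C Z A" and g: "g \<in> Hom C A Z"
      using assms(1) A unfolding zero_object_def by blast
    show "\<exists>!f. f \<in> Hom C W A"
    proof (rule ex1I)
      show "f \<cdot> inv_arr C u \<in> Hom C W A"
        using u f by (simp add: Hom_iff)
      then show "h = f \<cdot> inv_arr C u" if h: "h \<in> Hom C W A" for h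
        using Iso_cancel_right[OF assms(2) h]
          zero_object_unique(1)[OF assms(1) Comp_Hom[OF Iso_Hom[OF assms(2)] h]
            Comp_Hom[OF Iso_Hom[OF assms(2)]]]
        by blast
    qed
    show "\<exists>!f. f \<in> Hom C A W"
    proof (rule ex1I)
      show "u \<cdot> g \<in> Hom C A W"
        using u g by (simp add: Hom_iff)
      then show "h = u \<cdot> g" if h: "h \<in> Hom C A W" for h
        using Iso_cancel_left[OF inv_arr_Iso[OF assms(2)] h]
          zero_object_unique(2)[OF assms(1) Comp_Hom[OF h Iso_Hom[OF inv_arr_Iso[OF assms(2)]]]
            Comp_Hom[OF _ Iso_Hom[OF inv_arr_Iso[OF assms(2)]]]]
        by blast
    qed
  qed
  then show ?thesis
    using u by (simp add: zero_object_def)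
qed

end

section \<open>Functors and equivalences\<close>

context cat_functor
begin

lemma farr_simps [simp]:
  assumes "f \<in> Arr C"
  shows "farr F f \<in> Arr D" "Dom D (farr F f) = fobj F (Dom C f)"
    "Cod D (farr F f) = fobj F (Cod C f)"
  using farr_Hom[of f "Dom C f" "Cod C f"] assms by (auto simp: C.Hom_iff D.Hom_iff)

declare fobj_Obj [simp] farr_Ide [simp]

lemma farr_Comp_eq [simp]:
  assumes "f \<in> Arr C" "g \<in> Arr C" "Dom C g = Cod C f"
  shows "farr F (g \<cdot>\<^bsub>C\<^esub> f) = farr F g \<cdot>\<^bsub>D\<^esub> farr F f"
  using farr_Comp[of f "Dom C f" "Cod C f" g "Cod C g"] assms by (auto simp: C.Hom_iff)

lemma farr_Iso:
  assumes "f \<in> Iso C A B"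
  shows "farr F f \<in> Iso D (fobj F A) (fobj F B)"
    and "inv_arr D (farr F f) = farr F (inv_arr C f)"
proof -
  note f = C.Iso_simps[OF assms]
  have "farr F (inv_arr C f) \<cdot>\<^bsub>D\<^esub> farr F f = Ide D (fobj F A)"
    "farr F f \<cdot>\<^bsub>D\<^esub> farr F (inv_arr C f) = Ide D (fobj F B)"
    using f farr_Comp_eq farr_Ide by metis+
  then show "farr F f \<in> Iso D (fobj F A) (fobj F B)"
    and "inv_arr D (farr F f) = farr F (inv_arr C f)"
    using D.IsoI[of "farr F f" "fobj F A" "fobj F B" "farr F (inv_arr C f)"] f
    by (simp_all add: D.Hom_iff)
qed

text \<open>Naturality writes \<open>\<eta> B \<cdot> f\<close> in terms of
  \<open>farr G (farr F f)\<close>, and \<open>\<eta> B\<close> cancels. It serves both an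
  equivalence and, with the roles of the functors exchanged, its quasi-inverse.\<close>

lemma faithful_if_left_inverse:
  assumes \<eta>: "natural_iso C C id_functor (comp_functor G F) \<eta>"
    and f: "f \<in> Hom C A B" and g: "g \<in> Hom C A B" and "farr F f = farr F g"
  shows "f = g"
proof -
  have AB: "A \<in> Obj C" "B \<in> Obj C"
    using C.Hom_Obj[OF f] by auto
  have iso: "\<eta> B \<in> Iso C B (fobj G (fobj F B))"
    using \<eta> AB by (simp add: natural_iso_def id_functor_def comp_functor_def)
  have "\<eta> B \<cdot>\<^bsub>C\<^esub> f = \<eta> B \<cdot>\<^bsub>C\<^esub> g"
    using \<eta> AB f g assms(4) by (simp add: natural_iso_def id_functor_def comp_functor_def)
  then show ?thesis
    using C.Iso_cancel_left[OF iso f g] by simp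
qed

text \<open>The arrow \<open>f\<close> upstairs corresponds to \<open>f'\<close> downstairs along
  the isomorphisms \<open>u\<close> and \<open>v\<close> of their ends. Typing is part of the
  relation, so pasted squares carry everything needed for further pasting.\<close>

definition square :: "'m \<Rightarrow> 'q \<Rightarrow> 'q \<Rightarrow> 'q \<Rightarrow> bool" where
  "square f f' u v \<longleftrightarrow> f \<in> Arr C \<and> f' \<in> Arr D \<and>
     u \<in> Iso D (fobj F (Dom C f)) (Dom D f') \<and> v \<in> Iso D (fobj F (Cod C f)) (Cod D f') \<and>
     v \<cdot>\<^bsub>D\<^esub> farr F f = f' \<cdot>\<^bsub>D\<^esub> u"

lemma squareI:
  assumes "f \<in> Hom C A B" "f' \<in> Hom D A' B'" "u \<in> Iso D (fobj F A) A'" "v \<in> Iso D (fobj F B) B'"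
    and "v \<cdot>\<^bsub>D\<^esub> farr F f = f' \<cdot>\<^bsub>D\<^esub> u"
  shows "square f f' u v"
  using assms by (simp add: square_def C.Hom_iff D.Hom_iff)

lemma square_paste:
  assumes fs: "square f f' u v" and gs: "square g g' v w" and "Dom C g = Cod C f"
  shows "square (g \<cdot>\<^bsub>C\<^esub> f) (g' \<cdot>\<^bsub>D\<^esub> f') u w"
proof -
  have f: "f \<in> Arr C" "f' \<in> Arr D" "g \<in> Arr C" "g' \<in> Arr D"
    and eq: "v \<cdot>\<^bsub>D\<^esub> farr F f = f' \<cdot>\<^bsub>D\<^esub> u" "w \<cdot>\<^bsub>D\<^esub> farr F g = g' \<cdot>\<^bsub>D\<^esub> v"
    and iso: "u \<in> Iso D (fobj F (Dom C f)) (Dom D f')"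
      "v \<in> Iso D (fobj F (Cod C f)) (Cod D f')" "w \<in> Iso D (fobj F (Cod C g)) (Cod D g')"
    and v: "v \<in> Iso D (fobj F (Dom C g)) (Dom D g')"
    using fs gs by (auto simp: square_def)
  note u = D.Iso_simps[OF iso(1)] D.Iso_simps[OF iso(2)] D.Iso_simps[OF iso(3)]
  \<comment> \<open>The common side \<open>v\<close> ends at \<open>Cod D f'\<close> according to
    the first square and at \<open>Dom D g'\<close> according to the second.\<close>
  have dom: "Dom D g' = Cod D f'"
    using D.Iso_simps(3)[OF v] u by simp
  have "w \<cdot>\<^bsub>D\<^esub> (farr F g \<cdot>\<^bsub>D\<^esub> farr F f) = g' \<cdot>\<^bsub>D\<^esub> (v \<cdot>\<^bsub>D\<^esub> farr F f)"
    using D.Comp_extend[OF eq(2), of "farr F f"] f u dom assms(3) by simp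
  then show ?thesis
    using f u dom assms(3) iso eq by (simp add: square_def)
qed

text \<open>The square is transposed: \<open>farr F f\<close> and \<open>f'\<close> act as the
  invertible sides in \<open>square_inv\<close>, while \<open>u\<close> and \<open>v\<close> become
  the arrows being compared.\<close>

lemma square_inv_arr:
  assumes sq: "square f f' u v" and f: "f \<in> Iso C A B" and f': "f' \<in> Iso D A' B'"
  shows "square (inv_arr C f) (inv_arr D f') v u"
proof -
  note 1 = C.Iso_simps[OF f] D.Iso_simps[OF f']
  have u: "u \<in> Iso D (fobj F A) A'" and v: "v \<in> Iso D (fobj F B) B'"
    and eq: "f' \<cdot>\<^bsub>D\<^esub> u = v \<cdot>\<^bsub>D\<^esub> farr F f"
    using sq 1 by (auto simp: square_def)
  have "inv_arr D f' \<cdot>\<^bsub>D\<^esub> v = u \<cdot>\<^bsub>D\<^esub> inv_arr D (farr F f)"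
    using D.square_inv[OF farr_Iso(1)[OF f] f' D.Iso_Hom[OF u] D.Iso_Hom[OF v] eq] .
  then show ?thesis
    using squareI[OF C.Iso_Hom[OF C.inv_arr_Iso[OF f]] D.Iso_Hom[OF D.inv_arr_Iso[OF f']] v u]
      farr_Iso(2)[OF f] by simp
qed

end

section \<open>Equivalences are full, faithful and essentially surjective, and transfer
  squares\<close>

context cat_equivalence
begin

text \<open>Turns \<epsilon> into the shape that \<open>faithful_if_left_inverse\<close> expects, so
  that the quasi-inverse is faithful as well.\<close>

lemma natural_iso_inv_id:
  assumes G: "cat_functor D C G" and \<epsilon>: "natural_iso D D (comp_functor F G) id_functor \<epsilon>"
  shows "natural_iso D D id_functor (comp_functor F G) (\<lambda>B. inv_arr D (\<epsilon> B))"
proof -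
  interpret G: cat_functor D C G by fact
  have e: "\<epsilon> B \<in> Iso D (fobj F (fobj G B)) B" if "B \<in> Obj D" for B
    using \<epsilon> that by (simp add: natural_iso_def id_functor_def comp_functor_def)
  have "inv_arr D (\<epsilon> B) \<cdot>\<^bsub>D\<^esub> h = farr F (farr G h) \<cdot>\<^bsub>D\<^esub> inv_arr D (\<epsilon> A)"
    if AB: "A \<in> Obj D" "B \<in> Obj D" and h: "h \<in> Hom D A B" for A B h
  proof -
    note eA = D.Iso_simps[OF e[OF AB(1)]] and eB = D.Iso_simps[OF e[OF AB(2)]]
    have h': "h \<in> Arr D" "Dom D h = A" "Cod D h = B"
      using h by (auto simp: D.Hom_iff)
    have nat: "\<epsilon> B \<cdot>\<^bsub>D\<^esub> farr F (farr G h) = h \<cdot>\<^bsub>D\<^esub> \<epsilon> A"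
      using \<epsilon> AB h by (simp add: natural_iso_def id_functor_def comp_functor_def)
    have "\<epsilon> B \<cdot>\<^bsub>D\<^esub> (farr F (farr G h) \<cdot>\<^bsub>D\<^esub> inv_arr D (\<epsilon> A)) = h"
      using D.Comp_extend[OF nat, of "inv_arr D (\<epsilon> A)"] eA eB h' by simp
    moreover have "inv_arr D (\<epsilon> B) \<cdot>\<^bsub>D\<^esub> (\<epsilon> B \<cdot>\<^bsub>D\<^esub> (farr F (farr G h) \<cdot>\<^bsub>D\<^esub> inv_arr D (\<epsilon> A)))
        = farr F (farr G h) \<cdot>\<^bsub>D\<^esub> inv_arr D (\<epsilon> A)"
      using e[OF AB(2)] eA h' by simp
    ultimately show ?thesis
      by simp
  qed
  then show ?thesis
    using e D.inv_arr_Iso by (simp add: natural_iso_def id_functor_def comp_functor_def)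
qed

lemma faithful: "f \<in> Hom C A B \<Longrightarrow> g \<in> Hom C A B \<Longrightarrow> farr F f = farr F g \<longleftrightarrow> f = g"
  using quasi_inverse faithful_if_left_inverse by metis

text \<open>The candidate is \<open>G h\<close> conjugated by \<eta>. Naturality of \<eta> shows
  that \<open>F f\<close> and \<open>h\<close> have the same image under \<open>G\<close>, and
  \<open>G\<close> is faithful.\<close>

lemma full:
  assumes h: "h \<in> Hom D (fobj F A) (fobj F B)" and A: "A \<in> Obj C" and B: "B \<in> Obj C"
  shows "\<exists>f\<in>Hom C A B. farr F f = h"
proof -
  obtain G \<eta> \<epsilon> where G: "cat_functor D C G"
    and \<eta>: "natural_iso C C id_functor (comp_functor G F) \<eta>"
    and \<epsilon>: "natural_iso D D (comp_functor F G) id_functor \<epsilon>"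
    using quasi_inverse by blast
  interpret G: cat_functor D C G by fact
  have e: "\<eta> A \<in> Iso C A (fobj G (fobj F A))" if "A \<in> Obj C" for A
    using \<eta> that by (simp add: natural_iso_def id_functor_def comp_functor_def)
  note eA = C.Iso_simps[OF e[OF A]] and eB = C.Iso_simps[OF e[OF B]]
  have h': "h \<in> Arr D" "Dom D h = fobj F A" "Cod D h = fobj F B"
    using h by (auto simp: D.Hom_iff)
  define f where "f = inv_arr C (\<eta> B) \<cdot>\<^bsub>C\<^esub> (farr G h \<cdot>\<^bsub>C\<^esub> \<eta> A)"
  have f: "f \<in> Hom C A B"
    using eA eB h' by (simp add: f_def C.Hom_iff)
  have "farr G (farr F f) \<cdot>\<^bsub>C\<^esub> \<eta> A = \<eta> B \<cdot>\<^bsub>C\<^esub> f"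
    using \<eta> A B f by (simp add: natural_iso_def id_functor_def comp_functor_def)
  also have "\<dots> = farr G h \<cdot>\<^bsub>C\<^esub> \<eta> A"
    unfolding f_def using e[OF B] eA h' by simp
  finally have "farr G (farr F f) = farr G h"
    using C.Iso_cancel_right[OF e[OF A]] G.farr_Hom[OF farr_Hom[OF f]] G.farr_Hom[OF h] by blast
  then have "farr F f = h"
    using G.faithful_if_left_inverse[OF natural_iso_inv_id[OF G \<epsilon>] farr_Hom[OF f] h] by simp
  then show ?thesis
    using f by blast
qed

text \<open>Preimages are given as functions of the object, so that maps lifted at neighbouring
  filtration indices get matching ends.\<close>

lemma essentially_surjective: "\<exists>G e. \<forall>B\<in>Obj D. G B \<in> Obj C \<and> e B \<in> Iso D (fobj F (G B)) B"
proof -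
  obtain G \<epsilon> where G: "cat_functor D C G"
    and \<epsilon>: "natural_iso D D (comp_functor F G) id_functor \<epsilon>"
    using quasi_inverse by blast
  have "\<forall>B\<in>Obj D. fobj G B \<in> Obj C \<and> \<epsilon> B \<in> Iso D (fobj F (fobj G B)) B"
    using \<epsilon> cat_functor.fobj_Obj[OF G]
    by (simp add: natural_iso_def id_functor_def comp_functor_def)
  then show ?thesis
    by blast
qed

lemma Iso_reflect:
  assumes f: "f \<in> Hom C A B" and "farr F f \<in> Iso D (fobj F A) (fobj F B)"
  shows "f \<in> Iso C A B"
proof -
  note F = D.Iso_simps[OF assms(2)] and AB = C.Hom_Obj[OF f]
  obtain g where g: "g \<in> Hom C B A" "farr F g = inv_arr D (farr F f)"
    using full[OF _ AB(2,1), of "inv_arr D (farr F f)"] F by (auto simp: D.Hom_iff)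
  have "farr F (g \<cdot>\<^bsub>C\<^esub> f) = farr F (Ide C A)" "farr F (f \<cdot>\<^bsub>C\<^esub> g) = farr F (Ide C B)"
    using f g F AB by (simp_all add: C.Hom_iff)
  then have "g \<cdot>\<^bsub>C\<^esub> f = Ide C A" "f \<cdot>\<^bsub>C\<^esub> g = Ide C B"
    using f g(1) AB faithful by (meson C.Comp_Hom C.Ide_Hom)+
  then show ?thesis
    using C.IsoI(1) f g(1) by blast
qed

text \<open>Reflection needs only that maps lift uniquely. For preservation an arbitrary target
  \<open>B\<close> is first replaced by an isomorphic image object. Applied to \<psi>, and also to
  the shift.\<close>

lemma zero_object_farr:
  assumes Z: "Z \<in> Obj C"
  shows "zero_object D (fobj F Z) \<longleftrightarrow> zero_object C Z"
proof
  assume FZ: "zero_object D (fobj F Z)"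
  have "\<exists>!f. f \<in> Hom C Z A" "\<exists>!f. f \<in> Hom C A Z" if A: "A \<in> Obj C" for A
  proof -
    obtain f g where "f \<in> Hom D (fobj F Z) (fobj F A)" "g \<in> Hom D (fobj F A) (fobj F Z)"
      using FZ A unfolding zero_object_def by (meson fobj_Obj)
    then obtain f g where "f \<in> Hom C Z A" "g \<in> Hom C A Z"
      using full Z A by metis
    then show "\<exists>!f. f \<in> Hom C Z A" "\<exists>!f. f \<in> Hom C A Z"
      using D.zero_object_unique[OF FZ] farr_Hom faithful by metis+
  qed
  then show "zero_object C Z"
    using Z by (simp add: zero_object_def)
next
  assume CZ: "zero_object C Z"
  obtain G e where Ge: "\<forall>B\<in>Obj D. G B \<in> Obj C \<and> e B \<in> Iso D (fobj F (G B)) B"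
    using essentially_surjective by blast
  have "\<exists>!f. f \<in> Hom D (fobj F Z) B" "\<exists>!f. f \<in> Hom D B (fobj F Z)" if B: "B \<in> Obj D" for B
  proof -
    have e: "e B \<in> Iso D (fobj F (G B)) B" and GB: "G B \<in> Obj C"
      using Ge B by auto
    note eB = D.Iso_simps[OF e]
    obtain f g where f: "f \<in> Hom C Z (G B)" and g: "g \<in> Hom C (G B) Z"
      using CZ GB unfolding zero_object_def by meson
    have uniq: "h = farr F f" if "h \<in> Hom D (fobj F Z) (fobj F (G B))" for h
      using full[OF that Z GB] C.zero_object_unique(1)[OF CZ] f by metis
    have uniq': "h = farr F g" if "h \<in> Hom D (fobj F (G B)) (fobj F Z)" for h
      using full[OF that GB Z] C.zero_object_unique(2)[OF CZ] g by metis
    show "\<exists>!f. f \<in> Hom D (fobj F Z) B"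
    proof (rule ex1I)
      show "e B \<cdot>\<^bsub>D\<^esub> farr F f \<in> Hom D (fobj F Z) B"
        using eB f by (simp add: C.Hom_iff D.Hom_iff)
      show "h = e B \<cdot>\<^bsub>D\<^esub> farr F f" if h: "h \<in> Hom D (fobj F Z) B" for h
      proof -
        have "inv_arr D (e B) \<cdot>\<^bsub>D\<^esub> h = farr F f"
          using h eB by (intro uniq) (simp add: D.Hom_iff)
        then show ?thesis
          using D.Iso_inv_Comp(2)[OF e, of h] h by (simp add: D.Hom_iff)
      qed
    qed
    show "\<exists>!f. f \<in> Hom D B (fobj F Z)"
    proof (rule ex1I)
      show *: "farr F g \<cdot>\<^bsub>D\<^esub> inv_arr D (e B) \<in> Hom D B (fobj F Z)"
        using eB g by (simp add: C.Hom_iff D.Hom_iff)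
      show "h = farr F g \<cdot>\<^bsub>D\<^esub> inv_arr D (e B)" if h: "h \<in> Hom D B (fobj F Z)" for h
      proof -
        have "h \<cdot>\<^bsub>D\<^esub> e B = farr F g"
          using h eB by (intro uniq') (simp add: D.Hom_iff)
        also have "\<dots> = (farr F g \<cdot>\<^bsub>D\<^esub> inv_arr D (e B)) \<cdot>\<^bsub>D\<^esub> e B"
          using g eB by (simp add: C.Hom_iff)
        finally show ?thesis
          using D.Iso_cancel_right[OF e h *] by simp
      qed
    qed
  qed
  then show "zero_object D (fobj F Z)"
    using Z by (simp add: zero_object_def)
qed

lemma square_Iso_iff:
  assumes sq: "square f f' u v" and f: "f \<in> Hom C A B" and f': "f' \<in> Hom D A' B'"
  shows "f \<in> Iso C A B \<longleftrightarrow> f' \<in> Iso D A' B'"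
proof -
  have u: "u \<in> Iso D (fobj F A) A'" and v: "v \<in> Iso D (fobj F B) B'"
    and eq: "v \<cdot>\<^bsub>D\<^esub> farr F f = f' \<cdot>\<^bsub>D\<^esub> u"
    using sq f f' by (auto simp: square_def C.Hom_iff D.Hom_iff)
  note 1 = D.Iso_simps[OF u] D.Iso_simps[OF v] f[unfolded C.Hom_iff] f'[unfolded D.Hom_iff]
  have "f' = v \<cdot>\<^bsub>D\<^esub> (farr F f \<cdot>\<^bsub>D\<^esub> inv_arr D u)"
    using D.Comp_extend[OF eq, of "inv_arr D u"] 1 by simp
  moreover have "farr F f = inv_arr D v \<cdot>\<^bsub>D\<^esub> (f' \<cdot>\<^bsub>D\<^esub> u)"
    using eq D.Iso_inv_Comp(1)[OF v, of "farr F f"] 1 by simp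
  ultimately show ?thesis
    using farr_Iso(1) Iso_reflect[OF f] D.Comp_Iso D.inv_arr_Iso u v by metis
qed

lemma square_extend:
  assumes f: "f \<in> Hom C A B" and u: "u \<in> Iso D (fobj F A) A'" and v: "v \<in> Iso D (fobj F B) B'"
  shows "\<exists>f'\<in>Hom D A' B'. square f f' u v"
proof
  note 1 = D.Iso_simps[OF u] D.Iso_simps[OF v] f[unfolded C.Hom_iff]
  show *: "v \<cdot>\<^bsub>D\<^esub> (farr F f \<cdot>\<^bsub>D\<^esub> inv_arr D u) \<in> Hom D A' B'"
    using 1 by (simp add: D.Hom_iff)
  show "square f (v \<cdot>\<^bsub>D\<^esub> (farr F f \<cdot>\<^bsub>D\<^esub> inv_arr D u)) u v"
    using squareI[OF f * u v] 1 by simp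
qed

text \<open>Conjugating \<open>f'\<close> by the sides gives a map between image objects, which
  fullness lifts; \<open>square_extend\<close> is the same conjugation in the other
  direction.\<close>

lemma square_lift:
  assumes f': "f' \<in> Hom D A' B'" and A: "A \<in> Obj C" and B: "B \<in> Obj C"
    and u: "u \<in> Iso D (fobj F A) A'" and v: "v \<in> Iso D (fobj F B) B'"
  shows "\<exists>f\<in>Hom C A B. square f f' u v"
proof -
  note 1 = D.Iso_simps[OF u] D.Iso_simps[OF v] f'[unfolded D.Hom_iff]
  have "inv_arr D v \<cdot>\<^bsub>D\<^esub> (f' \<cdot>\<^bsub>D\<^esub> u) \<in> Hom D (fobj F A) (fobj F B)"
    using 1 by (simp add: D.Hom_iff)
  from full[OF this A B] obtain f where f: "f \<in> Hom C A B"
    and eq: "farr F f = inv_arr D v \<cdot>\<^bsub>D\<^esub> (f' \<cdot>\<^bsub>D\<^esub> u)"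
    by blast
  have "v \<cdot>\<^bsub>D\<^esub> farr F f = f' \<cdot>\<^bsub>D\<^esub> u"
    unfolding eq using D.Iso_inv_Comp(2)[OF v] 1 by simp
  then show ?thesis
    using squareI[OF f f' u v] f by blast
qed

text \<open>The device that carries equations between the categories: once both sides of an equation
  sit in squares with the same \<open>u\<close> and \<open>v\<close>, these cancel and faithfulness
  does the rest.\<close>

lemma square_eq_iff:
  assumes sf: "square f f' u v" and sg: "square g g' u v"
    and "Dom C f = Dom C g" "Cod C f = Cod C g"
  shows "f = g \<longleftrightarrow> f' = g'"
proof -
  have u: "u \<in> Iso D (fobj F (Dom C f)) (Dom D f')" and v: "v \<in> Iso D (fobj F (Cod C f)) (Cod D f')"
    and f: "f \<in> Arr C" "g \<in> Arr C" "f' \<in> Arr D" "g' \<in> Arr D"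
    and eq: "v \<cdot>\<^bsub>D\<^esub> farr F f = f' \<cdot>\<^bsub>D\<^esub> u" "v \<cdot>\<^bsub>D\<^esub> farr F g = g' \<cdot>\<^bsub>D\<^esub> u"
    using sf sg by (auto simp: square_def)
  have "Dom D f' = Dom D g'" "Cod D f' = Cod D g'"
    using sf sg D.Iso_simps(3)[OF u] D.Iso_simps(3)[OF v] D.Iso_simps(3) unfolding square_def by metis+
  then have "f' = g' \<longleftrightarrow> v \<cdot>\<^bsub>D\<^esub> farr F f = v \<cdot>\<^bsub>D\<^esub> farr F g"
    unfolding eq using D.Iso_cancel_right[OF u] f by (simp add: D.Hom_iff)
  also have "\<dots> \<longleftrightarrow> farr F f = farr F g"
    using D.Iso_cancel_left[OF v] f assms(3,4) by (simp add: D.Hom_iff)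
  also have "\<dots> \<longleftrightarrow> f = g"
    using faithful[of f "Dom C f" "Cod C f" g] f assms(3,4) by (simp add: C.Hom_iff)
  finally show ?thesis
    by simp
qed

end

section \<open>Cones in triangulated categories\<close>

context additive_category
begin

lemma Zero_Hom: "A \<in> Obj C \<Longrightarrow> B \<in> Obj C \<Longrightarrow> Zero C A B \<in> Hom C A B"
  using comm_group.axioms(1)[OF hom_comm_group] monoid.one_closed comm_monoid_def comm_group_def
  by (metis hom_group_def monoid.select_convs(2) partial_object.select_convs(1))

lemma hom_group_simps [simp]:
  "carrier (hom_group C A B) = Hom C A B" "monoid.mult (hom_group C A B) = Add C"
  "one (hom_group C A B) = Zero C A B"
  by (simp_all add: hom_group_def)

text \<open>Distributing over 0 + 0 = 0 makes the composite equal to its own double, hence the unit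
  of the hom group.\<close>

lemma Comp_Zero:
  assumes f: "f \<in> Hom C A B" and E: "E \<in> Obj C"
  shows "f \<cdot> Zero C E A = Zero C E B" "Zero C B E \<cdot> f = Zero C A E"
proof -
  have AB: "A \<in> Obj C" "B \<in> Obj C"
    using Hom_Obj[OF f] by auto
  interpret EA: comm_group "hom_group C E A" using hom_comm_group E AB by blast
  interpret EB: comm_group "hom_group C E B" using hom_comm_group E AB by blast
  interpret AE: comm_group "hom_group C A E" using hom_comm_group E AB by blast
  interpret BE: comm_group "hom_group C B E" using hom_comm_group E AB by blast
  have "Add C (f \<cdot> Zero C E A) (f \<cdot> Zero C E A) = f \<cdot> Zero C E A"
    using Comp_Add_right[OF Zero_Hom[OF E AB(1)] Zero_Hom[OF E AB(1)] f] EA.l_one[of "Zero C E A"]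
      Zero_Hom[OF E AB(1)] by simp
  then show "f \<cdot> Zero C E A = Zero C E B"
    using EB.l_cancel_one Comp_Hom[OF Zero_Hom[OF E AB(1)] f] by simp
  have "Add C (Zero C B E \<cdot> f) (Zero C B E \<cdot> f) = Zero C B E \<cdot> f"
    using Comp_Add_left[OF f Zero_Hom[OF AB(2) E] Zero_Hom[OF AB(2) E]] BE.l_one[of "Zero C B E"]
      Zero_Hom[OF AB(2) E] by simp
  then show "Zero C B E \<cdot> f = Zero C A E"
    using AE.l_cancel_one Comp_Hom[OF f Zero_Hom[OF AB(2) E]] by simp
qed

lemma neg_arr_Hom:
  assumes f: "f \<in> Hom C A B"
  shows "neg_arr C f \<in> Hom C A B" "neg_arr C (neg_arr C f) = f"
    "Add C f (neg_arr C f) = Zero C A B"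
proof -
  interpret comm_group "hom_group C A B" using hom_comm_group Hom_Obj[OF f] by blast
  have n: "neg_arr C g = inv\<^bsub>hom_group C A B\<^esub> g" if "g \<in> Hom C A B" for g
    using that by (simp add: neg_arr_def Hom_iff)
  show h: "neg_arr C f \<in> Hom C A B"
    using n inv_closed[of f] f by simp
  show "neg_arr C (neg_arr C f) = f"
    using n[OF h] n[OF f] f by simp
  show "Add C f (neg_arr C f) = Zero C A B"
    using n[OF f] r_inv[of f] f by simp
qed

lemma neg_arr_eqI:
  assumes f: "f \<in> Hom C A B" and g: "g \<in> Hom C A B" and "Add C f g = Zero C A B"
  shows "g = neg_arr C f"
proof -
  interpret comm_group "hom_group C A B" using hom_comm_group Hom_Obj[OF f] by blast
  show ?thesis
    using Units_l_cancel[of f g "neg_arr C f"] Units_eq assms neg_arr_Hom[OF f] by simp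
qed

lemma Comp_neg_arr:
  assumes f: "f \<in> Hom C A B" and g: "g \<in> Hom C B E"
  shows "g \<cdot> neg_arr C f = neg_arr C (g \<cdot> f)" "neg_arr C g \<cdot> f = neg_arr C (g \<cdot> f)"
proof -
  note gf = Comp_Hom[OF f g] and nf = neg_arr_Hom[OF f] and ng = neg_arr_Hom[OF g]
  show "g \<cdot> neg_arr C f = neg_arr C (g \<cdot> f)"
    using neg_arr_eqI[OF gf Comp_Hom[OF nf(1) g]] Comp_Add_right[OF f nf(1) g] nf(3)
      Comp_Zero[OF g] Hom_Obj[OF f] by simp
  show "neg_arr C g \<cdot> f = neg_arr C (g \<cdot> f)"
    using neg_arr_eqI[OF gf Comp_Hom[OF f ng(1)]] Comp_Add_left[OF f g ng(1)] ng(3)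
      Comp_Zero[OF f] Hom_Obj[OF g] by simp
qed

end

context triangulated_category
begin

lemma Tri_Hom:
  assumes "(f, g, h) \<in> Tri T"
  shows "f \<in> Hom T (Dom T f) (Dom T g)" "g \<in> Hom T (Dom T g) (Dom T h)"
    "h \<in> Hom T (Dom T h) (shO T (Dom T f))"
  using Tri_candidate[OF assms] by (auto simp: candidate_triangle_def Hom_iff)

lemma Tri_rotateD:
  assumes "(f, g, h) \<in> Tri T"
  shows "(g, h, neg_arr T (shA T f)) \<in> Tri T"
  using assms Tri_rotate Tri_candidate by blast

text \<open>The triangle is compared, after rotation, with the triangle of an identity whose cone is
  taken to be the same zero object \<open>Z\<close>. One fill-in yields a left inverse of \<Sigma>a,
  another a right inverse, and the shift reflects isomorphisms.\<close>

lemma Iso_if_zero_cone: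
  assumes tri: "(a, b, c) \<in> Tri T" and Z: "zero_object T (Dom T c)"
  shows "a \<in> Iso T (Dom T a) (Dom T b)"
proof -
  define A B Z where "A = Dom T a" and "B = Dom T b" and "Z = Dom T c"
  have Z: "zero_object T Z"
    using Z by (simp add: Z_def)
  have a: "a \<in> Hom T A B" and b: "b \<in> Hom T B Z" and c: "c \<in> Hom T Z (shO T A)"
    using Tri_Hom[OF tri] by (auto simp: A_def B_def Z_def)
  have o: "A \<in> Obj T" "B \<in> Obj T" "Z \<in> Obj T" "shO T A \<in> Obj T" "shO T B \<in> Obj T"
    "shO T Z \<in> Obj T"
    using Hom_Obj[OF a] Hom_Obj[OF b] by auto
  \<comment> \<open>Minus the identity of \<Sigma>E: the map that rotation puts in third place in
    the identity triangle.\<close>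
  define N where "N E = neg_arr T (Ide T (shO T E))" for E
  have N: "N E \<in> Hom T (shO T E) (shO T E)" if "E \<in> Obj T" for E
    unfolding N_def using neg_arr_Hom Ide_Hom that by simp
  have rot_Ide: "(Zero T E Z, Zero T Z (shO T E), N E) \<in> Tri T" if "E \<in> Obj T" for E
    using Tri_rotateD[OF Tri_Ide[OF that Z]] that by (simp add: N_def)
  have sa: "shA T a \<in> Hom T (shO T A) (shO T B)"
    using shift.farr_Hom[OF a] .
  note na = neg_arr_Hom[OF sa]
  have bc: "(b, c, neg_arr T (shA T a)) \<in> Tri T"
    using Tri_rotateD[OF tri] .
  note ca = Tri_rotateD[OF bc]
  have zA: "Zero T Z (shO T A) \<in> Hom T Z (shO T A)" "Zero T A Z \<in> Hom T A Z"
    and zB: "Zero T Z (shO T B) \<in> Hom T Z (shO T B)" "Zero T B Z \<in> Hom T B Z"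
    using Zero_Hom o by auto
  \<comment> \<open>Both triangles start at \<open>Z\<close> and continue to \<Sigma>A, so
    identities can be filled in. The signs of -\<Sigma>a and of \<open>N A\<close> then cancel,
    leaving \<open>w\<close> as a left inverse.\<close>
  have "\<exists>w\<in>Hom T (Dom T (neg_arr T (shA T b))) (Dom T (neg_arr T (shA T (Zero T A Z)))).
      w \<cdot> neg_arr T (shA T a) = N A \<cdot> Ide T (shO T A) \<and>
      shA T (Ide T Z) \<cdot> neg_arr T (shA T b) = neg_arr T (shA T (Zero T A Z)) \<cdot> w"
  proof (rule Tri_fill[OF ca Tri_rotateD[OF rot_Ide[OF o(1)]]])
    show "Ide T Z \<in> Hom T (Dom T c) (Dom T (Zero T Z (shO T A)))"
      using zA o c by (simp add: Hom_iff)
    show "Ide T (shO T A) \<in> Hom T (Dom T (neg_arr T (shA T a))) (Dom T (N A))"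
      using na N[OF o(1)] o by (simp add: Hom_iff)
    show "Ide T (shO T A) \<cdot> c = Zero T Z (shO T A) \<cdot> Ide T Z"
      using zero_object_unique(1)[OF Z c zA(1)] zA o by (simp add: Hom_iff)
  qed
  moreover have "neg_arr T (shA T b) \<in> Hom T (shO T B) (shO T Z)"
    "neg_arr T (shA T (Zero T A Z)) \<in> Hom T (shO T A) (shO T Z)"
    using neg_arr_Hom(1)[OF shift.farr_Hom] b zA by auto
  ultimately obtain w where w: "w \<in> Hom T (shO T B) (shO T A)"
    "w \<cdot> neg_arr T (shA T a) = N A"
    using N[OF o(1)] o by (auto simp: Hom_iff)
  have l: "w \<cdot> shA T a = Ide T (shO T A)"
    using w Comp_neg_arr(1)[OF sa w(1)] neg_arr_Hom(2)[OF Comp_Hom[OF sa w(1)]]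
      neg_arr_Hom(2)[OF Ide_Hom] o by (metis N_def)
  \<comment> \<open>One rotation less, and the opposite direction: -\<Sigma>a is now the third map
    of the target triangle, which gives the right inverse.\<close>
  have "\<exists>v\<in>Hom T (Dom T (N B)) (Dom T (neg_arr T (shA T a))).
      v \<cdot> Zero T Z (shO T B) = c \<cdot> Ide T Z \<and>
      shA T (Ide T B) \<cdot> N B = neg_arr T (shA T a) \<cdot> v"
  proof (rule Tri_fill[OF rot_Ide[OF o(2)] bc])
    show "Ide T B \<in> Hom T (Dom T (Zero T B Z)) (Dom T b)"
      using zB o b by (simp add: Hom_iff)
    show "Ide T Z \<in> Hom T (Dom T (Zero T Z (shO T B))) (Dom T c)"
      using zB o c by (simp add: Hom_iff)
    show "Ide T Z \<cdot> Zero T B Z = b \<cdot> Ide T B"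
      using zero_object_unique(2)[OF Z b zB(2)] zB o b by (simp add: Hom_iff)
  qed
  then obtain v where v: "v \<in> Hom T (shO T B) (shO T A)" "N B = neg_arr T (shA T a) \<cdot> v"
    using N[OF o(2)] o na by (auto simp: Hom_iff)
  have r: "shA T a \<cdot> v = Ide T (shO T B)"
    using v Comp_neg_arr(2)[OF v(1) sa] neg_arr_Hom(2)[OF Comp_Hom[OF v(1) sa]]
      neg_arr_Hom(2)[OF Ide_Hom] o by (metis N_def)
  show ?thesis
    using shift.Iso_reflect[OF a inverse_halves_Iso[OF sa w(1) v(1) l r]]
    by (simp add: A_def B_def)
qed

text \<open>After one rotation \<open>b\<close> is the first map, and its cone is the shift of the
  zero object \<open>Dom T a\<close>.\<close>

lemma Iso_if_zero_domain:
  assumes tri: "(a, b, c) \<in> Tri T" and Z: "zero_object T (Dom T a)"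
  shows "b \<in> Iso T (Dom T b) (Dom T c)"
proof -
  note h = Tri_Hom[OF tri]
  have "Dom T (neg_arr T (shA T a)) = shO T (Dom T a)"
    using neg_arr_Hom(1)[OF shift.farr_Hom[OF h(1)]] by (simp add: Hom_iff)
  then show ?thesis
    using Iso_if_zero_cone[OF Tri_rotateD[OF tri]] Z
    using shift.zero_object_farr Hom_Obj(1)[OF h(1)] by simp
qed

text \<open>Exactness of maps into \<open>D\<close> at the third object of the triangle. The
  condition on \<open>y\<close> is the commuting square needed to fill in a morphism from the
  rotated triangle to 0 -> D = D -> \<Sigma>0; its third component is the factor.\<close>

lemma factor_through_cone:
  assumes tri: "(f, g, h) \<in> Tri T" and y: "y \<in> Hom T (Dom T h) D"
    and yg: "y \<cdot> g = Zero T (Dom T g) D"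
  shows "\<exists>x\<in>Hom T (shO T (Dom T f)) D. x \<cdot> h = y"
proof -
  note t = Tri_Hom[OF tri]
  obtain Z where Z: "zero_object T Z"
    using ex_zero_object by blast
  have o: "D \<in> Obj T" "Z \<in> Obj T" "Dom T f \<in> Obj T" "Dom T g \<in> Obj T"
    using Hom_Obj[OF y] Hom_Obj[OF t(1)] Z by (auto simp: zero_object_def)
  have sZ: "zero_object T (shO T Z)"
    using shift.zero_object_farr Z o by simp
  have so: "shO T Z \<in> Obj T" "shO T D \<in> Obj T"
    using o by auto
  note z = Zero_Hom[OF o(2,1)] Zero_Hom[OF o(1) so(1)] Zero_Hom[OF o(4,2)]
  \<comment> \<open>The triangle 0 -> D = D is obtained by rotating backwards from an identity
    triangle with cone \<Sigma>Z; the map demanded there is the only one out of a zero object, so no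
    sign is left to compare.\<close>
  have "neg_arr T (shA T (Zero T Z D)) = Zero T (shO T Z) (shO T D)"
    using zero_object_unique(1)[OF sZ neg_arr_Hom(1)[OF shift.farr_Hom[OF z(1)]] Zero_Hom[OF so]] .
  then have tD: "(Zero T Z D, Ide T D, Zero T D (shO T Z)) \<in> Tri T"
    using Tri_rotate[of "Zero T Z D" "Ide T D" "Zero T D (shO T Z)"] Tri_Ide[OF o(1) sZ] z
      Ide_Hom[OF o(1)] unfolding candidate_triangle_def by auto
  have "\<exists>x\<in>Hom T (Dom T (neg_arr T (shA T f))) (Dom T (Zero T D (shO T Z))).
      x \<cdot> h = Ide T D \<cdot> y \<and>
      shA T (Zero T (Dom T g) Z) \<cdot> neg_arr T (shA T f) = Zero T D (shO T Z) \<cdot> x"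
  proof (rule Tri_fill[OF Tri_rotateD[OF tri] tD])
    show "Zero T (Dom T g) Z \<in> Hom T (Dom T g) (Dom T (Zero T Z D))"
      using z by (simp add: Hom_iff)
    show "y \<in> Hom T (Dom T h) (Dom T (Ide T D))"
      using y o by simp
    show "y \<cdot> g = Zero T Z D \<cdot> Zero T (Dom T g) Z"
      using yg Comp_Zero[OF z(1)] o by simp
  qed
  moreover have "neg_arr T (shA T f) \<in> Hom T (shO T (Dom T f)) (shO T (Dom T g))"
    using neg_arr_Hom(1)[OF shift.farr_Hom[OF t(1)]] .
  ultimately show ?thesis
    using z y by (auto simp: Hom_iff)
qed

text \<open>The difference \<open>d = e - 1\<close> factors as \<open>x \<cdot> h\<close>, hence \<open>d \<cdot> d = 0\<close> and \<open>1 - d\<close> is inverse to \<open>e\<close>.\<close>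

lemma cone_endomorphism_Iso:
  assumes tri: "(f, g, h) \<in> Tri T" and e: "e \<in> Hom T (Dom T h) (Dom T h)"
    and eg: "e \<cdot> g = g" and he: "h \<cdot> e = h"
  shows "e \<in> Iso T (Dom T h) (Dom T h)"
proof -
  note t = Tri_Hom[OF tri]
  define K where "K = Dom T h"
  have K: "K \<in> Obj T" and e: "e \<in> Hom T K K" and B: "Dom T g \<in> Obj T"
    using Hom_Obj[OF e] Hom_Obj[OF t(1)] e by (auto simp: K_def)
  note I = Ide_Hom[OF K]
  note nI = neg_arr_Hom[OF I]
  interpret KK: comm_group "hom_group T K K" using hom_comm_group K by blast
  interpret BK: comm_group "hom_group T (Dom T g) K" using hom_comm_group K B by blast
  have cl: "Add T u v \<in> Hom T K K" if "u \<in> Hom T K K" "v \<in> Hom T K K" for u v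
    using KK.m_closed that by simp
  have ac: "Add T (Add T u v) w = Add T u (Add T v w)"
    if "u \<in> Hom T K K" "v \<in> Hom T K K" "w \<in> Hom T K K" for u v w
    using KK.m_assoc that by simp
  have cm: "Add T u v = Add T v u" if "u \<in> Hom T K K" "v \<in> Hom T K K" for u v
    using KK.m_comm that by simp
  have zr: "Add T u (Zero T K K) = u" if "u \<in> Hom T K K" for u
    using KK.r_one that by simp
  define d where "d = Add T e (neg_arr T (Ide T K))"
  have d: "d \<in> Hom T K K"
    unfolding d_def using cl e nI by simp
  note nd = neg_arr_Hom[OF d]
  have eq: "e = Add T (Ide T K) d"
    unfolding d_def using ac cm cl zr e I nI by metis
  have g: "g \<in> Hom T (Dom T g) K"
    using t by (simp add: K_def)
  have "d \<cdot> g = Add T g (neg_arr T g)"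
    unfolding d_def using Comp_Add_left[OF g e nI(1)] Comp_neg_arr(2)[OF g I] eg g
    by (simp add: Hom_iff)
  then have "d \<cdot> g = Zero T (Dom T g) K"
    using neg_arr_Hom[OF g] by simp
  then obtain x where x: "x \<in> Hom T (shO T (Dom T f)) K" "x \<cdot> h = d"
    using factor_through_cone[OF tri] d by (auto simp: K_def)
  have h: "h \<in> Hom T K (shO T (Dom T f))"
    using t by (simp add: K_def)
  \<comment> \<open>Since \<open>d\<close> ends in \<open>h\<close> and \<open>h\<close> absorbs
    \<open>e\<close>, so does \<open>d\<close>. Expanding \<open>e = 1 + d\<close> turns this into
    \<open>d + d \<cdot> d = d\<close>, and \<open>e \<cdot> d\<close> expands to the same
    sum.\<close>
  have de: "d \<cdot> e = d"
    using Comp_assoc[OF e h x(1)] x(2) he by simp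
  have "Add T d (d \<cdot> d) = d"
    using Comp_Add_right[OF I d d] de d eq by (simp add: Hom_iff)
  moreover have ed: "e \<cdot> d = Add T d (d \<cdot> d)"
    using Comp_Add_left[OF d I d] d eq by (simp add: Hom_iff)
  ultimately have ed: "e \<cdot> d = d"
    by simp
  define k where "k = Add T (Ide T K) (neg_arr T d)"
  have k: "k \<in> Hom T K K"
    unfolding k_def using cl I nd by simp
  have ek: "Add T e (neg_arr T d) = Ide T K"
    using eq ac[OF I d nd(1)] nd(3) zr[OF I] by simp
  have "k \<cdot> e = Ide T K"
    unfolding k_def using Comp_Add_left[OF e I nd(1)] Comp_neg_arr(2)[OF e d] de ek e
    by (simp add: Hom_iff)
  moreover have "e \<cdot> k = Ide T K"
    unfolding k_def using Comp_Add_right[OF I nd(1) e] Comp_neg_arr(1)[OF d e] ed ek e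
    by (simp add: Hom_iff)
  ultimately show ?thesis
    using IsoI(1)[OF e k] by (simp add: K_def)
qed

text \<open>Filling in identities both ways gives \<open>a\<close> and \<open>b\<close>, which need
  not be mutually inverse. But \<open>b \<cdot> a\<close> and \<open>a \<cdot> b\<close> are
  endomorphisms compatible with their cones, hence invertible, and so \<open>a\<close> has inverses
  on both sides. Compatibility of \<open>a\<close> with the structure maps is kept, since reflection
  of triangles uses it.\<close>

lemma cone_unique:
  assumes t: "(f, g, h) \<in> Tri T" and t': "(f, g', h') \<in> Tri T"
  shows "\<exists>a\<in>Iso T (Dom T h) (Dom T h'). a \<cdot> g = g' \<and> h' \<cdot> a = h"
proof -
  have fill: "\<exists>a\<in>Hom T (Dom T h) (Dom T h'). a \<cdot> g = g' \<and> h' \<cdot> a = h"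
    if t: "(f, g, h) \<in> Tri T" and t': "(f, g', h') \<in> Tri T" for g h g' h'
  proof -
    note h = Tri_Hom[OF t] and h' = Tri_Hom[OF t']
    have o: "Dom T f \<in> Obj T" "Dom T g \<in> Obj T" and eq: "Dom T g = Dom T g'"
      using Hom_Obj[OF h(1)] h h' by (auto simp: Hom_iff)
    have "\<exists>w\<in>Hom T (Dom T h) (Dom T h').
        w \<cdot> g = g' \<cdot> Ide T (Dom T g) \<and> shA T (Ide T (Dom T f)) \<cdot> h = h' \<cdot> w"
      using Tri_fill[OF t t' Ide_Hom[OF o(1)], of "Ide T (Dom T g)"] Ide_Hom[OF o(2)] eq o h
      by (simp add: Hom_iff)
    then show ?thesis
      using o h h' eq by (metis Comp_Ide Ide_Comp shift.farr_Ide)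
  qed
  obtain a b where a: "a \<in> Hom T (Dom T h) (Dom T h')" "a \<cdot> g = g'" "h' \<cdot> a = h"
    and b: "b \<in> Hom T (Dom T h') (Dom T h)" "b \<cdot> g' = g" "h \<cdot> b = h'"
    using fill[OF t t'] fill[OF t' t] by blast
  note h = Tri_Hom[OF t] and h' = Tri_Hom[OF t']
  have eq: "Dom T g' = Dom T g" "shO T (Dom T f) \<in> Obj T"
    using h h' Hom_Obj[OF h(1)] by (auto simp: Hom_iff)
  have ba: "b \<cdot> a \<in> Iso T (Dom T h) (Dom T h)"
    using cone_endomorphism_Iso[OF t Comp_Hom[OF a(1) b(1)]]
      Comp_assoc[OF h(2) a(1) b(1)] Comp_assoc[OF a(1) b(1) h(3)] a b by simp
  have ab: "a \<cdot> b \<in> Iso T (Dom T h') (Dom T h')"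
    using cone_endomorphism_Iso[OF t' Comp_Hom[OF b(1) a(1)]]
      Comp_assoc[OF h'(2) b(1) a(1)] Comp_assoc[OF b(1) a(1) h'(3)] a b by simp
  have "a \<in> Iso T (Dom T h) (Dom T h')"
  proof (rule inverse_halves_Iso[OF a(1)])
    show "inv_arr T (b \<cdot> a) \<cdot> b \<in> Hom T (Dom T h') (Dom T h)"
      using Comp_Hom[OF b(1) Iso_Hom[OF inv_arr_Iso[OF ba]]] .
    show "b \<cdot> inv_arr T (a \<cdot> b) \<in> Hom T (Dom T h') (Dom T h)"
      using Comp_Hom[OF Iso_Hom[OF inv_arr_Iso[OF ab]] b(1)] .
    show "(inv_arr T (b \<cdot> a) \<cdot> b) \<cdot> a = Ide T (Dom T h)"
      using Comp_assoc[OF a(1) b(1) Iso_Hom[OF inv_arr_Iso[OF ba]]] Iso_simps(9)[OF ba] by simp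
    show "a \<cdot> (b \<cdot> inv_arr T (a \<cdot> b)) = Ide T (Dom T h')"
      using Comp_assoc[OF Iso_Hom[OF inv_arr_Iso[OF ab]] b(1) a(1)] Iso_simps(10)[OF ab] by simp
  qed
  then show ?thesis
    using a by blast
qed

lemma Tri_iso_iff:
  assumes c: "f \<in> Hom T A B" "g \<in> Hom T B D" "h \<in> Hom T D (shO T A)"
    and c': "f' \<in> Hom T A' B'" "g' \<in> Hom T B' D'" "h' \<in> Hom T D' (shO T A')"
    and iso: "u \<in> Iso T A A'" "v \<in> Iso T B B'" "w \<in> Iso T D D'"
    and sq: "v \<cdot> f = f' \<cdot> u" "w \<cdot> g = g' \<cdot> v" "shA T u \<cdot> h = h' \<cdot> w"
  shows "(f, g, h) \<in> Tri T \<longleftrightarrow> (f', g', h') \<in> Tri T"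
proof
  have cand: "candidate_triangle T f g h" "candidate_triangle T f' g' h'"
    using c c' unfolding candidate_triangle_def by blast+
  have dom: "Dom T f = A" "Dom T g = B" "Dom T h = D" "Dom T f' = A'" "Dom T g' = B'" "Dom T h' = D'"
    using c c' by (auto simp: Hom_iff)
  show "(f', g', h') \<in> Tri T" if "(f, g, h) \<in> Tri T"
    using Tri_iso[OF that cand(2)] iso sq unfolding dom by blast
  show "(f, g, h) \<in> Tri T" if "(f', g', h') \<in> Tri T"
  proof (rule Tri_iso[OF that cand(1)])
    show "inv_arr T u \<in> Iso T (Dom T f') (Dom T f)" "inv_arr T v \<in> Iso T (Dom T g') (Dom T g)"
      "inv_arr T w \<in> Iso T (Dom T h') (Dom T h)"
      using iso inv_arr_Iso unfolding dom by blast+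
    show "inv_arr T v \<cdot> f' = f \<cdot> inv_arr T u" "inv_arr T w \<cdot> g' = g \<cdot> inv_arr T v"
      using square_inv iso c c' sq by blast+
    show "shA T (inv_arr T u) \<cdot> h' = h \<cdot> inv_arr T w"
      using square_inv[OF iso(3) shift.farr_Iso(1)[OF iso(1)] c(3) c'(3) sq(3)]
        shift.farr_Iso(2)[OF iso(1)] by simp
  qed
qed

lemma shift_pow_Obj [simp]: "A \<in> Obj T \<Longrightarrow> (shO T ^^ k) A \<in> Obj T"
  by (induction k) auto

lemma shift_pow_Hom: "f \<in> Hom T A B \<Longrightarrow> (shA T ^^ k) f \<in> Hom T ((shO T ^^ k) A) ((shO T ^^ k) B)"
  by (induction k) (auto intro: shift.farr_Hom)

end

section \<open>Exact equivalences reflect triangles\<close>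

context exact_equivalence
begin

lemma tau_Iso: "A \<in> Obj T \<Longrightarrow> \<tau> A \<in> Iso T' (fobj \<psi> (shO T A)) (shO T' (fobj \<psi> A))"
  using shift_natural_iso by (simp add: natural_iso_def comp_functor_def)

lemma tau_natural: "f \<in> Hom T A B \<Longrightarrow> \<tau> B \<cdot>\<^bsub>T'\<^esub> farr \<psi> (shA T f) = shA T' (farr \<psi> f) \<cdot>\<^bsub>T'\<^esub> \<tau> A"
  using shift_natural_iso T.Hom_Obj by (simp add: natural_iso_def comp_functor_def)

text \<open>Complete \<open>f\<close> to some triangle in T. Its image and the given triangle have
  the same first map, so their cones are isomorphic; that isomorphism lifts to T by fullness, and
  its compatibilities descend by faithfulness.\<close>

lemma Tri_reflect:
  assumes f: "f \<in> Hom T A B" and g: "g \<in> Hom T B D" and h: "h \<in> Hom T D (shO T A)"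
    and tri: "(farr \<psi> f, farr \<psi> g, \<tau> A \<cdot>\<^bsub>T'\<^esub> farr \<psi> h) \<in> Tri T'"
  shows "(f, g, h) \<in> Tri T"
proof -
  obtain g' h' where t: "(f, g', h') \<in> Tri T"
    using T.Tri_ex[of f] f by (auto simp: T.Hom_iff)
  define D' where "D' = Dom T h'"
  have g': "g' \<in> Hom T B D'" and h': "h' \<in> Hom T D' (shO T A)"
    using T.Tri_Hom[OF t] f by (auto simp: D'_def T.Hom_iff)
  have A: "A \<in> Obj T" and D: "D \<in> Obj T" and D': "D' \<in> Obj T" and B: "B \<in> Obj T"
    using T.Hom_Obj f g g' by blast+
  note tau = tau_Iso[OF A]
  note tauH = T'.Iso_Hom[OF tau]
  have "(farr \<psi> f, farr \<psi> g', \<tau> A \<cdot>\<^bsub>T'\<^esub> farr \<psi> h') \<in> Tri T'"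
    using preserves_Tri[OF t] f by (simp add: T.Hom_iff)
  from T'.cone_unique[OF this tri] obtain a
    where a: "a \<in> Iso T' (fobj \<psi> D') (fobj \<psi> D)" "a \<cdot>\<^bsub>T'\<^esub> farr \<psi> g' = farr \<psi> g"
      "(\<tau> A \<cdot>\<^bsub>T'\<^esub> farr \<psi> h) \<cdot>\<^bsub>T'\<^esub> a = \<tau> A \<cdot>\<^bsub>T'\<^esub> farr \<psi> h'"
    using h h' tauH by (auto simp: T.Hom_iff T'.Hom_iff)
  obtain w where w: "w \<in> Hom T D' D" and wa: "farr \<psi> w = a"
    using full[OF T'.Iso_Hom[OF a(1)] D' D] by blast
  have iso: "w \<in> Iso T D' D"
    using Iso_reflect[OF w] a(1) wa by simp
  have "farr \<psi> (w \<cdot>\<^bsub>T\<^esub> g') = farr \<psi> g"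
    using a(2) wa farr_Comp[OF g' w] by simp
  then have wg: "w \<cdot>\<^bsub>T\<^esub> g' = g"
    using faithful[OF T.Comp_Hom[OF g' w] g] by simp
  have "\<tau> A \<cdot>\<^bsub>T'\<^esub> farr \<psi> (h \<cdot>\<^bsub>T\<^esub> w) = \<tau> A \<cdot>\<^bsub>T'\<^esub> farr \<psi> h'"
    using a(3) wa farr_Comp[OF w h] T'.Comp_assoc[OF farr_Hom[OF w] farr_Hom[OF h] tauH] by simp
  then have "farr \<psi> (h \<cdot>\<^bsub>T\<^esub> w) = farr \<psi> h'"
    using T'.Iso_cancel_left[OF tau farr_Hom[OF T.Comp_Hom[OF w h]] farr_Hom[OF h']] by simp
  then have hw: "h \<cdot>\<^bsub>T\<^esub> w = h'"
    using faithful[OF T.Comp_Hom[OF w h] h'] by simp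
  show ?thesis
    using T.Tri_iso_iff[OF f g' h' f g h T.Ide_Iso[OF A] T.Ide_Iso[OF B] iso] t wg hw f g h' A B
    by (simp add: T.Hom_iff)
qed

lemma Tri_iff:
  assumes f: "f \<in> Hom T A B" and g: "g \<in> Hom T B D" and h: "h \<in> Hom T D (shO T A)"
  shows "(farr \<psi> f, farr \<psi> g, \<tau> A \<cdot>\<^bsub>T'\<^esub> farr \<psi> h) \<in> Tri T' \<longleftrightarrow> (f, g, h) \<in> Tri T"
  using Tri_reflect[OF assms] preserves_Tri[of f g h] f by (auto simp: T.Hom_iff)

section \<open>Iterated shifts along \<psi>\<close>

lemma shift_iso_Iso:
  "A \<in> Obj T \<Longrightarrow> shift_iso T T' \<psi> \<tau> k A
    \<in> Iso T' (fobj \<psi> ((shO T ^^ k) A)) ((shO T' ^^ k) (fobj \<psi> A))"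
proof (induction k)
  case 0
  then show ?case
    by (simp add: T'.Ide_Iso)
next
  case (Suc k)
  then show ?case
    using T'.Comp_Iso[OF tau_Iso T'.shift.farr_Iso(1)] by simp
qed

text \<open>In the inductive step naturality of \<tau> moves the outermost shift past \<psi>, and
  the shifted induction hypothesis moves the remaining \<open>k\<close>.\<close>

lemma shift_iso_natural:
  assumes f: "f \<in> Hom T A B"
  shows "shift_iso T T' \<psi> \<tau> k B \<cdot>\<^bsub>T'\<^esub> farr \<psi> ((shA T ^^ k) f)
    = (shA T' ^^ k) (farr \<psi> f) \<cdot>\<^bsub>T'\<^esub> shift_iso T T' \<psi> \<tau> k A"
proof (induction k)
  case 0
  then show ?case
    using f T.Hom_Obj[OF f] by (simp add: T.Hom_iff)
next
  case (Suc k)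
  have AB: "A \<in> Obj T" "B \<in> Obj T"
    using T.Hom_Obj[OF f] by auto
  let ?s = "shift_iso T T' \<psi> \<tau> k" and ?t = "\<lambda>A. \<tau> ((shO T ^^ k) A)"
  let ?f = "(shA T ^^ k) f" and ?f' = "(shA T' ^^ k) (farr \<psi> f)"
  note s = T'.Iso_Hom[OF shift_iso_Iso[OF AB(1), of k]] T'.Iso_Hom[OF shift_iso_Iso[OF AB(2), of k]]
  note t = T'.Iso_Hom[OF tau_Iso[OF T.shift_pow_Obj[OF AB(1), of k]]]
    T'.Iso_Hom[OF tau_Iso[OF T.shift_pow_Obj[OF AB(2), of k]]]
  note F = T.shift_pow_Hom[OF f, of k]
  note F' = T'.shift_pow_Hom[OF farr_Hom[OF f], of k]
  have "(shA T' (?s B) \<cdot>\<^bsub>T'\<^esub> ?t B) \<cdot>\<^bsub>T'\<^esub> farr \<psi> (shA T ?f) = shA T' (?s B) \<cdot>\<^bsub>T'\<^esub> (?t B \<cdot>\<^bsub>T'\<^esub> farr \<psi> (shA T ?f))"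
    using T'.Comp_assoc[OF farr_Hom[OF T.shift.farr_Hom[OF F]] t(2) T'.shift.farr_Hom[OF s(2)]] .
  also have "\<dots> = shA T' (?s B) \<cdot>\<^bsub>T'\<^esub> (shA T' (farr \<psi> ?f) \<cdot>\<^bsub>T'\<^esub> ?t A)"
    using tau_natural[OF F] by simp
  also have "\<dots> = shA T' (?s B \<cdot>\<^bsub>T'\<^esub> farr \<psi> ?f) \<cdot>\<^bsub>T'\<^esub> ?t A"
    using T'.Comp_assoc[OF t(1) T'.shift.farr_Hom[OF farr_Hom[OF F]] T'.shift.farr_Hom[OF s(2)]]
      T'.shift.farr_Comp[OF farr_Hom[OF F] s(2)] by simp
  also have "\<dots> = shA T' (?f' \<cdot>\<^bsub>T'\<^esub> ?s A) \<cdot>\<^bsub>T'\<^esub> ?t A"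
    using Suc.IH by simp
  also have "\<dots> = shA T' ?f' \<cdot>\<^bsub>T'\<^esub> (shA T' (?s A) \<cdot>\<^bsub>T'\<^esub> ?t A)"
    using T'.Comp_assoc[OF t(1) T'.shift.farr_Hom[OF s(1)] T'.shift.farr_Hom[OF F']]
      T'.shift.farr_Comp[OF s(1) F'] by simp
  finally show ?case
    by simp
qed

text \<open>The new sides follow the recursion of \<open>shift_iso\<close>: a side
  \<open>s j\<close> becomes \<open>s (Suc j)\<close> under shifting.\<close>

lemma square_shift:
  assumes sq: "square f f' u v" and AB: "Dom T f = A" "Cod T f = B"
  shows "square (shA T f) (shA T' f') (shA T' u \<cdot>\<^bsub>T'\<^esub> \<tau> A) (shA T' v \<cdot>\<^bsub>T'\<^esub> \<tau> B)"
proof -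
  have f: "f \<in> Hom T A B" and f': "f' \<in> Hom T' (Dom T' f') (Cod T' f')"
    and u: "u \<in> Iso T' (fobj \<psi> A) (Dom T' f')" and v: "v \<in> Iso T' (fobj \<psi> B) (Cod T' f')"
    and eq: "v \<cdot>\<^bsub>T'\<^esub> farr \<psi> f = f' \<cdot>\<^bsub>T'\<^esub> u"
    using sq AB by (auto simp: square_def T.Hom_iff T'.Hom_iff)
  have "A \<in> Obj T" "B \<in> Obj T"
    using T.Hom_Obj[OF f] .
  note t = this[THEN tau_Iso]
  note su = T'.shift.farr_Iso(1)[OF u] and sv = T'.shift.farr_Iso(1)[OF v]
  note 1 = T'.Iso_simps[OF t(1)] T'.Iso_simps[OF t(2)] T'.Iso_simps[OF u] T'.Iso_simps[OF v]
  have "shA T' v \<cdot>\<^bsub>T'\<^esub> (\<tau> B \<cdot>\<^bsub>T'\<^esub> farr \<psi> (shA T f)) = shA T' (v \<cdot>\<^bsub>T'\<^esub> farr \<psi> f) \<cdot>\<^bsub>T'\<^esub> \<tau> A"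
    using tau_natural[OF f] f 1 by (simp add: T.Hom_iff)
  also have "\<dots> = shA T' f' \<cdot>\<^bsub>T'\<^esub> (shA T' u \<cdot>\<^bsub>T'\<^esub> \<tau> A)"
    using eq f f' 1 by (simp add: T.Hom_iff T'.Hom_iff)
  finally show ?thesis
    using squareI[OF T.shift.farr_Hom[OF f] T'.shift.farr_Hom[OF f'] T'.Comp_Iso[OF t(1) su]
        T'.Comp_Iso[OF t(2) sv]] f 1 by (simp add: T.Hom_iff)
qed

end

section \<open>Comparing filtered objects\<close>

text \<open>The typing part of \<open>exhibits_element\<close>: without the zero object, the
  triangles and the attaching equations, which are precisely the conditions to be carried
  across.\<close>

definition filtered_data ::
  "('o, 'm, 'a) triang_cat_scheme \<Rightarrow> nat \<Rightarrow> (nat \<Rightarrow> 'o) \<Rightarrow> ('o, 'm) filtered \<Rightarrow> (nat \<Rightarrow> 'm) \<Rightarrow> bool" where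
  "filtered_data T m A X \<phi> \<longleftrightarrow>
     top_iso X \<in> Iso T (fil X m) (total X) \<and>
     (\<forall>k\<le>m. fil X k \<in> Obj T) \<and>
     (\<forall>k<m. inc X k \<in> Hom T (fil X k) (fil X (k + 1)) \<and>
            proj X (k + 1) \<in> Hom T (fil X (k + 1)) (quo X k) \<and>
            conn X k \<in> Hom T (quo X k) (shO T (fil X k)) \<and>
            \<phi> k \<in> Iso T ((shO T ^^ k) (A k)) (quo X k))"

lemma filtered_dataD:
  assumes "filtered_data T m A X \<phi>"
  shows "top_iso X \<in> Iso T (fil X m) (total X)"
    and "k \<le> m \<Longrightarrow> fil X k \<in> Obj T"
    and "k < m \<Longrightarrow> inc X k \<in> Hom T (fil X k) (fil X (k + 1))"
    and "k < m \<Longrightarrow> proj X (k + 1) \<in> Hom T (fil X (k + 1)) (quo X k)"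
    and "k < m \<Longrightarrow> conn X k \<in> Hom T (quo X k) (shO T (fil X k))"
    and "k < m \<Longrightarrow> \<phi> k \<in> Iso T ((shO T ^^ k) (A k)) (quo X k)"
  using assms by (auto simp: filtered_data_def)

context triangulated_category
begin

lemma exhibits_element_filtered_data:
  assumes X: "exhibits_element T m A f X \<phi>"
  shows "filtered_data T m A X \<phi>"
proof -
  have "fil X k \<in> Obj T" if "k \<le> m" for k
  proof (cases k)
    case 0
    then show ?thesis
      using X by (simp add: exhibits_element_def filtered_object_def zero_object_def)
  next
    case (Suc j)
    then show ?thesis
      using X that Hom_Obj(2) unfolding exhibits_element_def filtered_object_def
      by (metis Suc_eq_plus1 Suc_le_eq)
  qed
  then show ?thesis
    using X by (simp add: exhibits_element_def filtered_object_def filtered_data_def)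
qed

lemma exhibits_element_iff:
  assumes "filtered_data T m A X \<phi>"
  shows "exhibits_element T m A f X \<phi> \<longleftrightarrow>
    zero_object T (fil X 0) \<and>
    (\<forall>k<m. (inc X k, proj X (k + 1), conn X k) \<in> Tri T) \<and>
    (\<forall>k\<in>{1..<m}. (shA T (proj X k) \<cdot> conn X k) \<cdot> \<phi> k = shA T (\<phi> (k - 1)) \<cdot> (shA T ^^ k) (f k))"
  using assms by (auto simp: exhibits_element_def filtered_object_def filtered_data_def)

lemma inc_comp_Hom:
  assumes "filtered_data T m A X \<phi>" "a + j \<le> m"
  shows "inc_comp T X a j \<in> Hom T (fil X a) (fil X (a + j))"
  using assms(2)
proof (induction j)
  case 0
  then show ?case
    using filtered_dataD(2)[OF assms(1)] Ide_Hom by simp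
next
  case (Suc j)
  then show ?case
    using filtered_dataD(3)[OF assms(1), of "a + j"] Comp_Hom by simp
qed

lemma proj_1_Iso:
  assumes "exhibits_element T m A f X \<phi>" "0 < m"
  shows "proj X 1 \<in> Iso T (fil X 1) (quo X 0)"
proof -
  have tri: "(inc X 0, proj X 1, conn X 0) \<in> Tri T" and Z: "zero_object T (fil X 0)"
    and "inc X 0 \<in> Hom T (fil X 0) (fil X 1)" "proj X 1 \<in> Hom T (fil X 1) (quo X 0)"
    "conn X 0 \<in> Hom T (quo X 0) (shO T (fil X 0))"
    using assms by (auto simp: exhibits_element_def filtered_object_def)
  then show ?thesis
    using Iso_if_zero_domain[OF tri] by (simp add: Hom_iff)
qed

text \<open>In contrast to \<open>sigma_Hom\<close>, typed data do not suffice: the inverse of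
  \<open>proj X 1\<close> exists because F_0 X is zero and the first triangle is
  distinguished.\<close>

lemma sigma'_Hom:
  assumes X: "exhibits_element T m A f X \<phi>" and m: "0 < m"
  shows "sigma' T m X \<phi> \<in> Hom T (A 0) (total X)"
proof -
  note d = exhibits_element_filtered_data[OF X]
  note 1 = Iso_simps[OF proj_1_Iso[OF X m]] Iso_simps[OF filtered_dataD(1)[OF d]]
    Iso_simps[OF filtered_dataD(6)[OF d m]]
  have "inc_comp T X 1 (m - 1) \<in> Hom T (fil X 1) (fil X m)"
    using inc_comp_Hom[OF d, of 1 "m - 1"] m by simp
  then show ?thesis
    using 1 by (simp add: sigma'_def Hom_iff)
qed

lemma sigma_Hom:
  assumes d: "filtered_data T m A X \<phi>" and m: "0 < m"
  shows "sigma T m X \<phi> \<in> Hom T (total X) ((shO T ^^ (m - 1)) (A (m - 1)))"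
proof -
  have "proj X m \<in> Hom T (fil X m) (quo X (m - 1))"
    using filtered_dataD(4)[OF d, of "m - 1"] m by simp
  moreover have "\<phi> (m - 1) \<in> Iso T ((shO T ^^ (m - 1)) (A (m - 1))) (quo X (m - 1))"
    using filtered_dataD(6)[OF d] m by simp
  note Iso_simps[OF this]
  ultimately show ?thesis
    using Iso_simps[OF filtered_dataD(1)[OF d]] by (simp add: sigma_def Hom_iff)
qed

end

text \<open>All sides run from the image of X to X': \<open>e\<close> on filtration stages,
  \<open>q\<close> on quotients, \<open>t\<close> on the total object. On shifted objects the sides
  are forced by \<tau>: the target of \<open>conn\<close> needs one \<tau>, the source of
  \<open>\<phi> k\<close> the k-fold iterate. Neither X nor X' is assumed to be a filtered
  object.\<close>

locale filtered_comparison = exact_equivalence T T' \<psi> \<tau>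
  for T :: "('o, 'm, 'a) triang_cat_scheme" and T' :: "('p, 'q, 'b) triang_cat_scheme"
    and \<psi> :: "('o, 'm, 'p, 'q) functor_data" and \<tau> :: "'o \<Rightarrow> 'q" +
  fixes m :: nat and A :: "nat \<Rightarrow> 'o" and f :: "nat \<Rightarrow> 'm"
    and X :: "('o, 'm) filtered" and \<phi> :: "nat \<Rightarrow> 'm"
    and X' :: "('p, 'q) filtered" and \<phi>' :: "nat \<Rightarrow> 'q"
    and e q :: "nat \<Rightarrow> 'q" and t :: 'q
  assumes m_pos: "0 < m"
    and A_Obj: "k < m \<Longrightarrow> A k \<in> Obj T"
    and f_Hom: "k \<in> {1..<m} \<Longrightarrow> f k \<in> Hom T (A k) (A (k - 1))"
    and data: "filtered_data T m A X \<phi>"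
    and data': "filtered_data T' m (\<lambda>k. fobj \<psi> (A k)) X' \<phi>'"
    and e_Iso: "k \<le> m \<Longrightarrow> e k \<in> Iso T' (fobj \<psi> (fil X k)) (fil X' k)"
    and q_Iso: "k < m \<Longrightarrow> q k \<in> Iso T' (fobj \<psi> (quo X k)) (quo X' k)"
    and t_Iso: "t \<in> Iso T' (fobj \<psi> (total X)) (total X')"
    and square_inc: "k < m \<Longrightarrow> square (inc X k) (inc X' k) (e k) (e (k + 1))"
    and square_proj: "k < m \<Longrightarrow> square (proj X (k + 1)) (proj X' (k + 1)) (e (k + 1)) (q k)"
    and square_conn:
      "k < m \<Longrightarrow> square (conn X k) (conn X' k) (q k) (shA T' (e k) \<cdot>\<^bsub>T'\<^esub> \<tau> (fil X k))"
    and square_top: "square (top_iso X) (top_iso X') (e m) t"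
    and square_phi: "k < m \<Longrightarrow> square (\<phi> k) (\<phi>' k) (shift_iso T T' \<psi> \<tau> k (A k)) (q k)"
begin

abbreviation s :: "nat \<Rightarrow> 'o \<Rightarrow> 'q" where
  "s \<equiv> shift_iso T T' \<psi> \<tau>"

lemma zero_iff: "zero_object T' (fil X' 0) \<longleftrightarrow> zero_object T (fil X 0)"
  using zero_object_farr[OF filtered_dataD(2)[OF data, of 0]] e_Iso[of 0]
    T'.zero_object_Iso T'.inv_arr_Iso by blast

lemma Tri_X_iff:
  assumes k: "k < m"
  shows "(inc X' k, proj X' (k + 1), conn X' k) \<in> Tri T'
    \<longleftrightarrow> (inc X k, proj X (k + 1), conn X k) \<in> Tri T"
proof -
  note x = filtered_dataD(3-5)[OF data k] and x' = filtered_dataD(3-5)[OF data' k]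
  have o: "fil X k \<in> Obj T" "k \<le> m"
    using filtered_dataD(2)[OF data] k by auto
  note tau = T'.Iso_Hom[OF tau_Iso[OF o(1)]] and c = farr_Hom[OF x(3)]
  note ek = T'.shift.farr_Hom[OF T'.Iso_Hom[OF e_Iso[OF o(2)]]]
  \<comment> \<open>Regrouped so that \<tau> is attached to the image of \<open>conn X k\<close>:
    this composite is the third map of the image triangle.\<close>
  have "shA T' (e k) \<cdot>\<^bsub>T'\<^esub> (\<tau> (fil X k) \<cdot>\<^bsub>T'\<^esub> farr \<psi> (conn X k)) = conn X' k \<cdot>\<^bsub>T'\<^esub> q k"
    using square_conn[OF k] T'.Comp_assoc[OF c tau ek] by (simp add: square_def)
  moreover have "e (k + 1) \<cdot>\<^bsub>T'\<^esub> farr \<psi> (inc X k) = inc X' k \<cdot>\<^bsub>T'\<^esub> e k"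
    "q k \<cdot>\<^bsub>T'\<^esub> farr \<psi> (proj X (k + 1)) = proj X' (k + 1) \<cdot>\<^bsub>T'\<^esub> e (k + 1)"
    using square_inc[OF k] square_proj[OF k] by (simp_all add: square_def)
  ultimately have "(farr \<psi> (inc X k), farr \<psi> (proj X (k + 1)), \<tau> (fil X k) \<cdot>\<^bsub>T'\<^esub> farr \<psi> (conn X k))
      \<in> Tri T' \<longleftrightarrow> (inc X' k, proj X' (k + 1), conn X' k) \<in> Tri T'"
    using k by (intro T'.Tri_iso_iff[OF farr_Hom[OF x(1)] farr_Hom[OF x(2)]
        T'.Comp_Hom[OF c tau] x' e_Iso e_Iso q_Iso]) simp_all
  then show ?thesis
    using Tri_iff[OF x] by simp
qed

lemma attaching_iff:
  assumes k: "k \<in> {1..<m}"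
  shows "(shA T' (proj X' k) \<cdot>\<^bsub>T'\<^esub> conn X' k) \<cdot>\<^bsub>T'\<^esub> \<phi>' k
        = shA T' (\<phi>' (k - 1)) \<cdot>\<^bsub>T'\<^esub> (shA T' ^^ k) (farr \<psi> (f k))
    \<longleftrightarrow> (shA T (proj X k) \<cdot>\<^bsub>T\<^esub> conn X k) \<cdot>\<^bsub>T\<^esub> \<phi> k = shA T (\<phi> (k - 1)) \<cdot>\<^bsub>T\<^esub> (shA T ^^ k) (f k)"
    (is "?l' = ?r' \<longleftrightarrow> ?l = ?r")
proof -
  obtain j where j: "k = Suc j" "j < m" "k < m" "k \<le> m"
    using k by (cases k) auto
  have fk: "f k \<in> Hom T (A k) (A j)"
    using f_Hom[OF k] j by simp
  have dom: "\<phi> k \<in> Hom T ((shO T ^^ k) (A k)) (quo X k)"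
    "conn X k \<in> Hom T (quo X k) (shO T (fil X k))" "proj X k \<in> Hom T (fil X k) (quo X j)"
    "\<phi> j \<in> Hom T ((shO T ^^ j) (A j)) (quo X j)"
    using filtered_dataD(4)[OF data j(2)] filtered_dataD(5)[OF data j(3)]
      T.Iso_Hom[OF filtered_dataD(6)[OF data j(3)]] T.Iso_Hom[OF filtered_dataD(6)[OF data j(2)]] j(1)
    by simp_all
  note F = T.shift_pow_Hom[OF fk, of k]
  note dom = dom[unfolded T.Hom_iff] F[unfolded T.Hom_iff]
  have p: "square (shA T (proj X k)) (shA T' (proj X' k)) (shA T' (e k) \<cdot>\<^bsub>T'\<^esub> \<tau> (fil X k))
      (shA T' (q j) \<cdot>\<^bsub>T'\<^esub> \<tau> (quo X j))"
    using square_shift[OF square_proj[OF j(2)], of "fil X k" "quo X j"] dom j(1) by simp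
  \<comment> \<open>As \<open>k = Suc j\<close>, the shifted side \<open>s j (A j)\<close> is
    \<open>s k (A j)\<close>, the very side on which the square \<open>F\<close> of the shifted
    \<open>f k\<close> ends. This is why the two can be pasted.\<close>
  have P: "square (shA T (\<phi> j)) (shA T' (\<phi>' j)) (s k (A j)) (shA T' (q j) \<cdot>\<^bsub>T'\<^esub> \<tau> (quo X j))"
    using square_shift[OF square_phi[OF j(2)] refl refl] dom j(1) by simp
  have F: "square ((shA T ^^ k) (f k)) ((shA T' ^^ k) (farr \<psi> (f k))) (s k (A k)) (s k (A j))"
    using squareI[OF F T'.shift_pow_Hom[OF farr_Hom[OF fk]] shift_iso_Iso shift_iso_Iso
        shift_iso_natural[OF fk]] A_Obj j by simp
  have "square ?l ?l' (s k (A k)) (shA T' (q j) \<cdot>\<^bsub>T'\<^esub> \<tau> (quo X j))"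
    by (intro square_paste[OF square_phi[OF j(3)]] square_paste[OF square_conn[OF j(3)] p])
      (simp_all add: dom)
  moreover have "square ?r ?r' (s k (A k)) (shA T' (q j) \<cdot>\<^bsub>T'\<^esub> \<tau> (quo X j))"
    using square_paste[OF F P] dom j by simp
  moreover have "Dom T ?l = Dom T ?r" "Cod T ?l = Cod T ?r"
    using dom j by simp_all
  ultimately show ?thesis
    using square_eq_iff by blast
qed

lemma exhibits_iff:
  "exhibits_element T m A f X \<phi> \<longleftrightarrow>
   exhibits_element T' m (\<lambda>k. fobj \<psi> (A k)) (\<lambda>k. farr \<psi> (f k)) X' \<phi>'"
  unfolding T.exhibits_element_iff[OF data] T'.exhibits_element_iff[OF data']
  using zero_iff Tri_X_iff attaching_iff by auto

lemma square_inc_comp: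
  "a + j \<le> m \<Longrightarrow> square (inc_comp T X a j) (inc_comp T' X' a j) (e a) (e (a + j))"
proof (induction j)
  case 0
  then have "a \<le> m"
    by simp
  note T'.Iso_simps[OF e_Iso[OF this]] filtered_dataD(2)[OF data this]
  then show ?case
    using e_Iso[OF \<open>a \<le> m\<close>] by (simp add: square_def)
next
  case (Suc j)
  then show ?case
    using square_paste[OF Suc.IH square_inc[of "a + j"]] filtered_dataD(3)[OF data, of "a + j"]
      T.inc_comp_Hom[OF data, of a j] by (simp add: T.Hom_iff)
qed

lemma square_sigma':
  assumes "exhibits_element T m A f X \<phi>"
  shows "square (sigma' T m X \<phi>) (sigma' T' m X' \<phi>') (Ide T' (fobj \<psi> (A 0))) t"
proof -
  note ex' = assms[unfolded exhibits_iff]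
  have inc: "square (inc_comp T X 1 (m - 1)) (inc_comp T' X' 1 (m - 1)) (e 1) (e m)"
    using square_inc_comp[of 1 "m - 1"] m_pos by simp
  note p = T.proj_1_Iso[OF assms m_pos] and p' = T'.proj_1_Iso[OF ex' m_pos]
  have "square (proj X 1) (proj X' 1) (e 1) (q 0)"
    using square_proj[OF m_pos] by simp
  note p_inv = square_inv_arr[OF this p p']
  have dom: "\<phi> 0 \<in> Hom T (A 0) (quo X 0)" "inc_comp T X 1 (m - 1) \<in> Hom T (fil X 1) (fil X m)"
    using T.Iso_Hom[OF filtered_dataD(6)[OF data m_pos]] T.inc_comp_Hom[OF data, of 1 "m - 1"] m_pos by simp_all
  note dom = dom[unfolded T.Hom_iff] T.Iso_simps[OF p] T.Iso_simps[OF filtered_dataD(1)[OF data]]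
  \<comment> \<open>Pasting leaves \<open>s 0 (A 0)\<close>, the zeroth iterate of \<tau>, which is
    the identity by definition.\<close>
  have "square (sigma' T m X \<phi>) (sigma' T' m X' \<phi>') (s 0 (A 0)) t"
    unfolding sigma'_def
    by (intro square_paste[OF _ square_top] square_paste[OF _ inc] square_paste[OF _ p_inv]
      square_phi[OF m_pos]) (simp_all add: dom del: One_nat_def)
  then show ?thesis
    by simp
qed

lemma square_sigma:
  "square (sigma T m X \<phi>) (sigma T' m X' \<phi>') t (s (m - 1) (A (m - 1)))"
proof -
  have k: "m - 1 < m"
    using m_pos by simp
  note P = filtered_dataD(6)[OF data k] and P' = filtered_dataD(6)[OF data' k]
  note P_inv = square_inv_arr[OF square_phi[OF k] P P']
  note top_inv = square_inv_arr[OF square_top filtered_dataD(1)[OF data] filtered_dataD(1)[OF data']]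
  have p: "square (proj X m) (proj X' m) (e m) (q (m - 1))"
    using square_proj[OF k] m_pos by simp
  have "proj X m \<in> Hom T (fil X m) (quo X (m - 1))"
    using filtered_dataD(4)[OF data k] m_pos by simp
  note dom = this[unfolded T.Hom_iff] T.Iso_simps[OF P] T.Iso_simps[OF filtered_dataD(1)[OF data]]
  show ?thesis
    unfolding sigma_def
    by (intro square_paste[OF _ P_inv] square_paste[OF _ p] top_inv)
      (simp_all add: dom del: One_nat_def)
qed

text \<open>Partners \<beta> and \<beta>' are matched along \<open>s (m - 1) B\<close> and
  \<open>t\<close>, partners \<alpha> and \<alpha>' along \<open>t\<close> and an identity. Then all
  three equations compare squares with common sides. The inverse of \<open>s (m - 1) B\<close> makes
  the image of \<theta> start at the shift of the image of B.\<close>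

lemma bracket_condition_iff:
  assumes ex: "exhibits_element T m A f X \<phi>"
    and g: "g \<in> Hom T B (A (m - 1))" and h: "h \<in> Hom T (A 0) D"
    and \<theta>: "\<theta> \<in> Hom T ((shO T ^^ (m - 1)) B) D"
  shows "(\<exists>\<beta>\<in>Hom T ((shO T ^^ (m - 1)) B) (total X). \<exists>\<alpha>\<in>Hom T (total X) D.
      (shA T ^^ (m - 1)) g = sigma T m X \<phi> \<cdot>\<^bsub>T\<^esub> \<beta> \<and> h = \<alpha> \<cdot>\<^bsub>T\<^esub> sigma' T m X \<phi> \<and> \<theta> = \<alpha> \<cdot>\<^bsub>T\<^esub> \<beta>) \<longleftrightarrow>
    (\<exists>\<beta>\<in>Hom T' ((shO T' ^^ (m - 1)) (fobj \<psi> B)) (total X'). \<exists>\<alpha>\<in>Hom T' (total X') (fobj \<psi> D).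
      (shA T' ^^ (m - 1)) (farr \<psi> g) = sigma T' m X' \<phi>' \<cdot>\<^bsub>T'\<^esub> \<beta> \<and>
      farr \<psi> h = \<alpha> \<cdot>\<^bsub>T'\<^esub> sigma' T' m X' \<phi>' \<and>
      farr \<psi> \<theta> \<cdot>\<^bsub>T'\<^esub> inv_arr T' (s (m - 1) B) = \<alpha> \<cdot>\<^bsub>T'\<^esub> \<beta>)"
    (is "(\<exists>\<beta>\<in>?B. \<exists>\<alpha>\<in>?A. ?P \<beta> \<alpha>) \<longleftrightarrow> (\<exists>\<beta>\<in>?B'. \<exists>\<alpha>\<in>?A'. ?P' \<beta> \<alpha>)")
proof -
  have o: "B \<in> Obj T" "D \<in> Obj T" "A 0 \<in> Obj T" "total X \<in> Obj T"
    using T.Hom_Obj[OF g] T.Hom_Obj[OF h]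
      T.Iso_simps(5)[OF filtered_dataD(1)[OF data]] by auto
  note S = shift_iso_Iso[OF o(1), of "m - 1"]
  have ID: "Ide T' (fobj \<psi> D) \<in> Iso T' (fobj \<psi> D) (fobj \<psi> D)"
    using o T'.Ide_Iso by simp
  note G = T.shift_pow_Hom[OF g, of "m - 1"]
  note sg = T.sigma_Hom[OF data m_pos] and sg' = T.sigma'_Hom[OF ex m_pos]
  have sq_g: "square ((shA T ^^ (m - 1)) g) ((shA T' ^^ (m - 1)) (farr \<psi> g))
      (s (m - 1) B) (s (m - 1) (A (m - 1)))"
    using squareI[OF G T'.shift_pow_Hom[OF farr_Hom[OF g]] S shift_iso_Iso shift_iso_natural[OF g]]
      T.Hom_Obj[OF g] by simp
  have sq_h: "square h (farr \<psi> h) (Ide T' (fobj \<psi> (A 0))) (Ide T' (fobj \<psi> D))"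
    using squareI[OF h farr_Hom[OF h] T'.Ide_Iso ID] o h by (simp add: T.Hom_iff)
  have sq_th: "square \<theta> (farr \<psi> \<theta> \<cdot>\<^bsub>T'\<^esub> inv_arr T' (s (m - 1) B)) (s (m - 1) B) (Ide T' (fobj \<psi> D))"
    using squareI[OF \<theta> T'.Comp_Hom[OF T'.Iso_Hom[OF T'.inv_arr_Iso[OF S]] farr_Hom[OF \<theta>]] S ID]
      T'.Iso_simps[OF S] \<theta> by (simp add: T.Hom_iff)
  have iff: "?P \<beta> \<alpha> \<longleftrightarrow> ?P' \<beta>' \<alpha>'"
    if \<beta>: "\<beta> \<in> ?B" and \<alpha>: "\<alpha> \<in> ?A" and sq: "square \<beta> \<beta>' (s (m - 1) B) t"
      "square \<alpha> \<alpha>' t (Ide T' (fobj \<psi> D))" for \<alpha> \<beta> \<alpha>' \<beta>'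
  proof -
    note dom = \<alpha>[unfolded T.Hom_iff] \<beta>[unfolded T.Hom_iff] G[unfolded T.Hom_iff]
      sg[unfolded T.Hom_iff] sg'[unfolded T.Hom_iff] h[unfolded T.Hom_iff] \<theta>[unfolded T.Hom_iff]
    have "square (sigma T m X \<phi> \<cdot>\<^bsub>T\<^esub> \<beta>) (sigma T' m X' \<phi>' \<cdot>\<^bsub>T'\<^esub> \<beta>')
        (s (m - 1) B) (s (m - 1) (A (m - 1)))"
      "square (\<alpha> \<cdot>\<^bsub>T\<^esub> sigma' T m X \<phi>) (\<alpha>' \<cdot>\<^bsub>T'\<^esub> sigma' T' m X' \<phi>')
        (Ide T' (fobj \<psi> (A 0))) (Ide T' (fobj \<psi> D))"
      "square (\<alpha> \<cdot>\<^bsub>T\<^esub> \<beta>) (\<alpha>' \<cdot>\<^bsub>T'\<^esub> \<beta>') (s (m - 1) B) (Ide T' (fobj \<psi> D))"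
      using square_paste[OF sq(1) square_sigma] square_paste[OF square_sigma'[OF ex] sq(2)]
        square_paste[OF sq] dom by simp_all
    from square_eq_iff[OF sq_g this(1)] square_eq_iff[OF sq_h this(2)]
      square_eq_iff[OF sq_th this(3)]
    show ?thesis
      using dom by simp
  qed
  show ?thesis
  proof
    assume "\<exists>\<beta>\<in>?B. \<exists>\<alpha>\<in>?A. ?P \<beta> \<alpha>"
    then obtain \<beta> \<alpha> where *: "\<beta> \<in> ?B" "\<alpha> \<in> ?A" "?P \<beta> \<alpha>"
      by blast
    then show "\<exists>\<beta>\<in>?B'. \<exists>\<alpha>\<in>?A'. ?P' \<beta> \<alpha>"
      using square_extend[OF *(1) S t_Iso] square_extend[OF *(2) t_Iso ID] iff[OF *(1,2)] by meson
  next
    assume "\<exists>\<beta>\<in>?B'. \<exists>\<alpha>\<in>?A'. ?P' \<beta> \<alpha>"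
    then obtain \<beta> \<alpha> where *: "\<beta> \<in> ?B'" "\<alpha> \<in> ?A'" "?P' \<beta> \<alpha>"
      by blast
    then show "\<exists>\<beta>\<in>?B. \<exists>\<alpha>\<in>?A. ?P \<beta> \<alpha>"
      using square_lift[OF *(1) T.shift_pow_Obj[OF o(1)] o(4) S t_Iso]
        square_lift[OF *(2) o(4,2) t_Iso ID] iff by meson
  qed
qed

end

section \<open>Existence of comparison partners in both directions\<close>

context exact_equivalence
begin

lemma conn_comparison_Iso:
  assumes "B \<in> Obj T" "u \<in> Iso T' (fobj \<psi> B) B'"
  shows "shA T' u \<cdot>\<^bsub>T'\<^esub> \<tau> B \<in> Iso T' (fobj \<psi> (shO T B)) (shO T' B')"
  using T'.Comp_Iso[OF tau_Iso T'.shift.farr_Iso(1)] assms by blast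

text \<open>The comparison isomorphisms on objects of X are identities, so inclusions and
  projections are plain images; \<open>conn\<close> acquires a factor \<tau>, and
  \<open>\<phi>' k\<close> is the image of \<open>\<phi> k\<close> precomposed with the inverse of
  \<open>shift_iso\<close>.\<close>

lemma ex_image_comparison:
  assumes m: "0 < m" and A: "\<And>k. k < m \<Longrightarrow> A k \<in> Obj T"
    and f: "\<And>k. k \<in> {1..<m} \<Longrightarrow> f k \<in> Hom T (A k) (A (k - 1))"
    and X: "filtered_data T m A X \<phi>"
  shows "\<exists>X' \<phi>' e q t. filtered_comparison T T' \<psi> \<tau> m A f X \<phi> X' \<phi>' e q t"
proof -
  let ?F = "\<lambda>k. fobj \<psi> (fil X k)" and ?Q = "\<lambda>k. fobj \<psi> (quo X k)" and ?s = "shift_iso T T' \<psi> \<tau>"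
  define I where "I Y = Ide T' (fobj \<psi> Y)" for Y
  have I: "I Y \<in> Iso T' (fobj \<psi> Y) (fobj \<psi> Y)" if "Y \<in> Obj T" for Y
    unfolding I_def using that T'.Ide_Iso by simp
  note x = filtered_dataD[OF X]
  have o: "quo X k \<in> Obj T" "fil X k \<in> Obj T" "fil X (k + 1) \<in> Obj T" if "k < m" for k
    using T.Hom_Obj[OF x(4)] T.Hom_Obj[OF x(3)] that by auto
  have "\<forall>k\<in>{..<m}. \<exists>i\<in>Hom T' (?F k) (?F (k + 1)).
      square (inc X k) i (I (fil X k)) (I (fil X (k + 1)))"
    using square_extend[OF x(3) I I] o by simp
  then obtain i where i: "\<And>k. k < m \<Longrightarrow> i k \<in> Hom T' (?F k) (?F (k + 1))"
    "\<And>k. k < m \<Longrightarrow> square (inc X k) (i k) (I (fil X k)) (I (fil X (k + 1)))"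
    by (metis (no_types, lifting) lessThan_iff)
  have "\<forall>k\<in>{..<m}. \<exists>p\<in>Hom T' (?F (k + 1)) (?Q k).
      square (proj X (k + 1)) p (I (fil X (k + 1))) (I (quo X k))"
    using square_extend[OF x(4) I I] o by simp
  then obtain p where p: "\<And>k. k < m \<Longrightarrow> p k \<in> Hom T' (?F (k + 1)) (?Q k)"
    "\<And>k. k < m \<Longrightarrow> square (proj X (k + 1)) (p k) (I (fil X (k + 1))) (I (quo X k))"
    by (metis (no_types, lifting) lessThan_iff)
  have "\<forall>k\<in>{..<m}. \<exists>c\<in>Hom T' (?Q k) (shO T' (?F k)).
      square (conn X k) c (I (quo X k)) (shA T' (I (fil X k)) \<cdot>\<^bsub>T'\<^esub> \<tau> (fil X k))"
    using square_extend[OF x(5) I conn_comparison_Iso[OF _ I]] o by simp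
  then obtain c where c: "\<And>k. k < m \<Longrightarrow> c k \<in> Hom T' (?Q k) (shO T' (?F k))"
    "\<And>k. k < m \<Longrightarrow> square (conn X k) (c k) (I (quo X k)) (shA T' (I (fil X k)) \<cdot>\<^bsub>T'\<^esub> \<tau> (fil X k))"
    by (metis (no_types, lifting) lessThan_iff)
  have "\<forall>k\<in>{..<m}. \<exists>\<phi>'\<in>Hom T' ((shO T' ^^ k) (fobj \<psi> (A k))) (?Q k).
      square (\<phi> k) \<phi>' (?s k (A k)) (I (quo X k))"
    using square_extend[OF T.Iso_Hom[OF x(6)] shift_iso_Iso[OF A] I] o by simp
  then obtain \<phi>' where phi: "\<And>k. k < m \<Longrightarrow> \<phi>' k \<in> Hom T' ((shO T' ^^ k) (fobj \<psi> (A k))) (?Q k)"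
    "\<And>k. k < m \<Longrightarrow> square (\<phi> k) (\<phi>' k) (?s k (A k)) (I (quo X k))"
    by (metis (no_types, lifting) lessThan_iff)
  have phi_Iso: "\<phi>' k \<in> Iso T' ((shO T' ^^ k) (fobj \<psi> (A k))) (?Q k)" if "k < m" for k
    using square_Iso_iff[OF phi(2) T.Iso_Hom[OF x(6)] phi(1)] x(6) that by blast
  note top = T.Iso_simps(4,5)[OF x(1)]
  obtain a where a: "a \<in> Hom T' (?F m) (fobj \<psi> (total X))"
    "square (top_iso X) a (I (fil X m)) (I (total X))"
    using square_extend[OF T.Iso_Hom[OF x(1)] I I] top by blast
  have a_Iso: "a \<in> Iso T' (?F m) (fobj \<psi> (total X))"
    using square_Iso_iff[OF a(2) T.Iso_Hom[OF x(1)] a(1)] x(1) by blast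
  \<comment> \<open>\<open>p k\<close> plays the part of the projection with index
    \<open>k + 1\<close>, hence the index shift; the value of \<open>proj\<close> at 0 is
    irrelevant.\<close>
  define X' where "X' = \<lparr>total = fobj \<psi> (total X), fil = ?F, inc = i, top_iso = a, quo = ?Q,
    proj = (\<lambda>k. p (k - 1)), conn = c\<rparr>"
  have "filtered_comparison T T' \<psi> \<tau> m A f X \<phi> X' \<phi>' (\<lambda>k. I (fil X k)) (\<lambda>k. I (quo X k)) (I (total X))"
  proof unfold_locales
    show "filtered_data T' m (\<lambda>k. fobj \<psi> (A k)) X' \<phi>'"
      using a_Iso x(2) i p c phi_Iso by (simp add: filtered_data_def X'_def)
  qed (use m A f X I o x(2) top a i p c phi in \<open>simp_all add: X'_def\<close>)
  then show ?thesis
    by blast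
qed

text \<open>Stages, quotients and total object are chosen preimages, compared by \<epsilon>. The
  sources of the \<open>\<phi> k\<close> are not chosen but are the given shifts of
  \<open>A k\<close>, so there the comparison is \<open>shift_iso\<close>.\<close>

lemma ex_preimage_comparison:
  assumes m: "0 < m" and A: "\<And>k. k < m \<Longrightarrow> A k \<in> Obj T"
    and f: "\<And>k. k \<in> {1..<m} \<Longrightarrow> f k \<in> Hom T (A k) (A (k - 1))"
    and X': "filtered_data T' m (\<lambda>k. fobj \<psi> (A k)) X' \<phi>'"
  shows "\<exists>X \<phi> e q t. filtered_comparison T T' \<psi> \<tau> m A f X \<phi> X' \<phi>' e q t"
proof -
  let ?s = "shift_iso T T' \<psi> \<tau>"
  obtain G \<epsilon> where G: "\<And>B. B \<in> Obj T' \<Longrightarrow> G B \<in> Obj T"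
    and \<epsilon>: "\<And>B. B \<in> Obj T' \<Longrightarrow> \<epsilon> B \<in> Iso T' (fobj \<psi> (G B)) B"
    using essentially_surjective by blast
  let ?F = "\<lambda>k. G (fil X' k)" and ?Q = "\<lambda>k. G (quo X' k)"
    and ?e = "\<lambda>k. \<epsilon> (fil X' k)" and ?q = "\<lambda>k. \<epsilon> (quo X' k)"
  note x = filtered_dataD[OF X']
  have o: "quo X' k \<in> Obj T'" "fil X' k \<in> Obj T'" "fil X' (k + 1) \<in> Obj T'" if "k < m" for k
    using T'.Hom_Obj[OF x(4)] T'.Hom_Obj[OF x(3)] that by auto
  have "\<forall>k\<in>{..<m}. \<exists>i\<in>Hom T (?F k) (?F (k + 1)). square i (inc X' k) (?e k) (?e (k + 1))"
    using square_lift[OF x(3) G G \<epsilon> \<epsilon>] o by simp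
  then obtain i where i: "\<And>k. k < m \<Longrightarrow> i k \<in> Hom T (?F k) (?F (k + 1))"
    "\<And>k. k < m \<Longrightarrow> square (i k) (inc X' k) (?e k) (?e (k + 1))"
    by (metis (no_types, lifting) lessThan_iff)
  have "\<forall>k\<in>{..<m}. \<exists>p\<in>Hom T (?F (k + 1)) (?Q k). square p (proj X' (k + 1)) (?e (k + 1)) (?q k)"
    using square_lift[OF x(4) G G \<epsilon> \<epsilon>] o by simp
  then obtain p where p: "\<And>k. k < m \<Longrightarrow> p k \<in> Hom T (?F (k + 1)) (?Q k)"
    "\<And>k. k < m \<Longrightarrow> square (p k) (proj X' (k + 1)) (?e (k + 1)) (?q k)"
    by (metis (no_types, lifting) lessThan_iff)
  have "\<forall>k\<in>{..<m}. \<exists>c\<in>Hom T (?Q k) (shO T (?F k)).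
      square c (conn X' k) (?q k) (shA T' (?e k) \<cdot>\<^bsub>T'\<^esub> \<tau> (?F k))"
    using square_lift[OF x(5) G T.shift.fobj_Obj[OF G] \<epsilon> conn_comparison_Iso[OF G \<epsilon>]] o by simp
  then obtain c where c: "\<And>k. k < m \<Longrightarrow> c k \<in> Hom T (?Q k) (shO T (?F k))"
    "\<And>k. k < m \<Longrightarrow> square (c k) (conn X' k) (?q k) (shA T' (?e k) \<cdot>\<^bsub>T'\<^esub> \<tau> (?F k))"
    by (metis (no_types, lifting) lessThan_iff)
  have "\<forall>k\<in>{..<m}. \<exists>\<phi>\<in>Hom T ((shO T ^^ k) (A k)) (?Q k). square \<phi> (\<phi>' k) (?s k (A k)) (?q k)"
    using square_lift[OF T'.Iso_Hom[OF x(6)] T.shift_pow_Obj[OF A] G shift_iso_Iso[OF A] \<epsilon>] o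
    by simp
  then obtain \<phi> where phi: "\<And>k. k < m \<Longrightarrow> \<phi> k \<in> Hom T ((shO T ^^ k) (A k)) (?Q k)"
    "\<And>k. k < m \<Longrightarrow> square (\<phi> k) (\<phi>' k) (?s k (A k)) (?q k)"
    by (metis (no_types, lifting) lessThan_iff)
  have phi_Iso: "\<phi> k \<in> Iso T ((shO T ^^ k) (A k)) (?Q k)" if "k < m" for k
    using square_Iso_iff[OF phi(2,1) T'.Iso_Hom[OF x(6)]] x(6) that by blast
  note top = T'.Iso_simps(4,5)[OF x(1)]
  obtain a where a: "a \<in> Hom T (?F m) (G (total X'))"
    "square a (top_iso X') (?e m) (\<epsilon> (total X'))"
    using square_lift[OF T'.Iso_Hom[OF x(1)] G G \<epsilon> \<epsilon>] top by blast
  have a_Iso: "a \<in> Iso T (?F m) (G (total X'))"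
    using square_Iso_iff[OF a(2,1) T'.Iso_Hom[OF x(1)]] x(1) by blast
  define X where "X = \<lparr>total = G (total X'), fil = ?F, inc = i, top_iso = a, quo = ?Q,
    proj = (\<lambda>k. p (k - 1)), conn = c\<rparr>"
  have "filtered_comparison T T' \<psi> \<tau> m A f X \<phi> X' \<phi>' ?e ?q (\<epsilon> (total X'))"
  proof unfold_locales
    show "filtered_data T m A X \<phi>"
      using a_Iso x(2) G i p c phi_Iso by (simp add: filtered_data_def X_def)
  qed (use m A f X' \<epsilon> o x(2) top a i p c phi in \<open>simp_all add: X_def\<close>)
  then show ?thesis
    by blast
qed

end

section \<open>From comparisons of filtered objects to Toda brackets\<close>

theorem theorem1p4:
  fixes T :: "('o, 'm) triang_cat" and T' :: "('p, 'q) triang_cat"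
    and \<psi> :: "('o, 'm, 'p, 'q) functor_data" and \<tau> :: "'o \<Rightarrow> 'q"
    and n :: nat and A :: "nat \<Rightarrow> 'o" and f :: "nat \<Rightarrow> 'm" and \<theta> :: 'm
  assumes "exact_equivalence T T' \<psi> \<tau>"
    and "n \<ge> 2"
    and "composable_seq T n A f"
    and "\<theta> \<in> Hom T ((shO T ^^ (n - 2)) (A n)) (A 0)"
  shows "\<theta> \<in> toda_bracket T n A f \<longleftrightarrow>
    farr \<psi> \<theta> \<cdot>\<^bsub>T'\<^esub> inv_arr T' (shift_iso T T' \<psi> \<tau> (n - 2) (A n))
      \<in> toda_bracket T' n (\<lambda>k. fobj \<psi> (A k)) (\<lambda>k. farr \<psi> (f k))"
proof -
  interpret exact_equivalence T T' \<psi> \<tau> by fact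
  \<comment> \<open>An n-fold bracket uses (n-1)-filtered objects built on A_1, ..., A_(n-1);
    \<open>?A\<close> and \<open>?f\<close> renumber these from 0, so \<open>f n\<close> ends at
    \<open>?A (m - 1)\<close> and \<open>f 1\<close> starts at \<open>?A 0\<close>.\<close>
  define m where "m = n - 1"
  have n: "n = m + 1" "n - 1 = m" "n - 2 = m - 1" and m: "0 < m" "m - 1 + 1 = m"
    using assms(2) by (auto simp: m_def)
  let ?A = "\<lambda>k. A (k + 1)" and ?f = "\<lambda>k. f (k + 1)"
  have A: "A k \<in> Obj T" if "k \<le> n" for k
    using assms(3) that by (simp add: composable_seq_def)
  have f: "f k \<in> Hom T (A k) (A (k - 1))" if "k \<in> {1..n}" for k
    using assms(3) that by (simp add: composable_seq_def)
  have A': "?A k \<in> Obj T" if "k < m" for k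
    using A that by (simp add: n)
  have f': "?f k \<in> Hom T (?A k) (?A (k - 1))" if "k \<in> {1..<m}" for k
    using f[of "k + 1"] that by (simp add: n)
  have f_ends: "f n \<in> Hom T (A n) (?A (m - 1))" "f 1 \<in> Hom T (?A 0) (A 0)"
    using f[of n] f[of 1] m by (simp_all add: n)
  have th: "\<theta> \<in> Hom T ((shO T ^^ (m - 1)) (A n)) (A 0)"
    using assms(4) by (simp add: n)
  let ?s = "shift_iso T T' \<psi> \<tau> (m - 1) (A n)"
  let ?P = "\<lambda>X \<phi>. exhibits_element T m ?A ?f X \<phi> \<and>
    (\<exists>\<beta>\<in>Hom T ((shO T ^^ (m - 1)) (A n)) (total X). \<exists>\<alpha>\<in>Hom T (total X) (A 0).
      (shA T ^^ (m - 1)) (f n) = sigma T m X \<phi> \<cdot>\<^bsub>T\<^esub> \<beta> \<and> f 1 = \<alpha> \<cdot>\<^bsub>T\<^esub> sigma' T m X \<phi> \<and>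
      \<theta> = \<alpha> \<cdot>\<^bsub>T\<^esub> \<beta>)"
  let ?P' = "\<lambda>X' \<phi>'. exhibits_element T' m (\<lambda>k. fobj \<psi> (?A k)) (\<lambda>k. farr \<psi> (?f k)) X' \<phi>' \<and>
    (\<exists>\<beta>\<in>Hom T' ((shO T' ^^ (m - 1)) (fobj \<psi> (A n))) (total X').
     \<exists>\<alpha>\<in>Hom T' (total X') (fobj \<psi> (A 0)).
      (shA T' ^^ (m - 1)) (farr \<psi> (f n)) = sigma T' m X' \<phi>' \<cdot>\<^bsub>T'\<^esub> \<beta> \<and>
      farr \<psi> (f 1) = \<alpha> \<cdot>\<^bsub>T'\<^esub> sigma' T' m X' \<phi>' \<and>
      farr \<psi> \<theta> \<cdot>\<^bsub>T'\<^esub> inv_arr T' ?s = \<alpha> \<cdot>\<^bsub>T'\<^esub> \<beta>)"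
  have iff: "?P X \<phi> \<longleftrightarrow> ?P' X' \<phi>'"
    if "filtered_comparison T T' \<psi> \<tau> m ?A ?f X \<phi> X' \<phi>' e q t" for X \<phi> X' \<phi>' e q t
  proof -
    interpret cmp: filtered_comparison T T' \<psi> \<tau> m ?A ?f X \<phi> X' \<phi>' e q t by fact
    show ?thesis
      using cmp.exhibits_iff cmp.bracket_condition_iff[OF _ f_ends th] by blast
  qed
  have "(\<exists>X \<phi>. ?P X \<phi>) \<longleftrightarrow> (\<exists>X' \<phi>'. ?P' X' \<phi>')"
  proof
    assume "\<exists>X \<phi>. ?P X \<phi>"
    then obtain X \<phi> where P: "?P X \<phi>"
      by blast
    then obtain X' \<phi>' e q t where "filtered_comparison T T' \<psi> \<tau> m ?A ?f X \<phi> X' \<phi>' e q t"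
      using ex_image_comparison[where A = ?A and f = ?f, OF m(1) A' f' T.exhibits_element_filtered_data] by blast
    from iff[OF this] P show "\<exists>X' \<phi>'. ?P' X' \<phi>'"
      by blast
  next
    assume "\<exists>X' \<phi>'. ?P' X' \<phi>'"
    then obtain X' \<phi>' where P: "?P' X' \<phi>'"
      by blast
    then obtain X \<phi> e q t where "filtered_comparison T T' \<psi> \<tau> m ?A ?f X \<phi> X' \<phi>' e q t"
      using ex_preimage_comparison[where A = ?A and f = ?f, OF m(1) A' f' T'.exhibits_element_filtered_data] by blast
    from iff[OF this] P show "\<exists>X \<phi>. ?P X \<phi>"
      by blast
  qed
  \<comment> \<open>The bracket in T' also demands membership in the hom set, which the equivalence
    of the existential conditions does not provide.\<close>
  moreover have "farr \<psi> \<theta> \<cdot>\<^bsub>T'\<^esub> inv_arr T' ?s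
      \<in> Hom T' ((shO T' ^^ (m - 1)) (fobj \<psi> (A n))) (fobj \<psi> (A 0))"
    using T'.Comp_Hom[OF T'.Iso_Hom[OF T'.inv_arr_Iso[OF shift_iso_Iso]] farr_Hom[OF th]] A by simp
  ultimately show ?thesis
    unfolding toda_bracket_def n(2,3) mem_Collect_eq using th by simp
qed

end
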